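(* Let $(V_1,F_1)$ be a Minkowski normed space, $V_2$ a vector space, and $\mu:V_1\to V_2$ a linear and surjective map. Then: (i) there exists an induced homogeneous nonlinear lift $\mathbf h:V_2\to V_1$ (for $\mu$); (ii) there exists a unique Minkowski norm $F_2:V_2\to\mathbb{R}$ on $V_2$ for which $\mu$ is a submersion between the Minkowski spaces $(V_1,F_1)$ and $(V_2,F_2)$, and it is given by $$F_2(v):=\inf\{F_1(u) : \mu(u)=v\}$$ (the subduced norm); (iii) the nonlinear lift $\mathbf h$ of (i) and the Minkowski norms $F_1$ and $F_2$ are related by $$F_1(\mathbf h(v))=F_2(v)\qquad\text{for all } v\in V_2 .$$
   Context: Vector spaces are real and finite-dimensional. A Minkowski norm $F$ on a vector space $V$ is a non-negative real-valued function that is $C^\infty$ on $V\setminus\{0\}$, positively homogeneous ($F(\lambda u)=\lambda F(u)$ for $\lambda>0$, with $F(0)=0$), and strongly convex: the Hessian matrix $\left(\frac{\partial^2 (\frac12F^2)}{\partial u^a\partial u^b}(u)\right)$ in linear coordinates is positive definite for each $u\in V\setminus\{0\}$. The pair $(V,F)$ is a Minkowski normed space, with closed unit ball $\overline{B_F}=\{u : F(u)\le 1\}$. A surjective linear map $\mu:V_1\to V_2$ is a submersion between Minkowski normed spaces $(V_1,F_1)$, $(V_2,F_2)$ if $\mu(\overline{B_{F_1}})=\overline{B_{F_2}}$. For a surjective linear map $\mu:V_1\to V_2$, a nonlinear lift is a continuous map $\mathbf h:V_2\to V_1$, smooth on $V_2\setminus\{0\}$, with $\mu\circ\mathbf h=\mathrm{id}$.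 It is homogeneous if $\mathbf h(\lambda v)=\lambda\mathbf h(v)$ for all $\lambda>0$, $v\in V_2$. "Induced" means that $\mathbf h(v)$ is the unique vector of $\mu^{-1}(v)$ at which the restriction of $F_1$ to $\mu^{-1}(v)$ attains its minimum. *)

theory Defs
  imports "HOL-Analysis.Analysis"
begin

text \<open>
  A finite-dimensional real vector space is a type of class \<^class>\<open>real_normed_vector\<close> that is spanned
  by a finite set. This covers every dimension, including 0. The norm of the type only serves to
  provide the topology and the derivatives; in finite dimension these do not depend on its choice,
  and it is unrelated to the Minkowski norms below.
\<close>

definition finite_dimensional :: "'a::real_vector itself \<Rightarrow> bool" where
  "finite_dimensional _ \<longleftrightarrow> (\<exists>B::'a set. finite B \<and> span B = UNIV)"

definition is_basis :: "'a::real_vector set \<Rightarrow> bool" where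
  "is_basis B \<longleftrightarrow> independent B \<and> span B = UNIV"

text \<open>To be used for open sets \<open>S\<close> only.\<close>

primrec Ck_on :: "nat \<Rightarrow> ('a::real_normed_vector \<Rightarrow> 'b::real_normed_vector) \<Rightarrow> 'a set \<Rightarrow> bool" where
  "Ck_on 0 f S \<longleftrightarrow> continuous_on S f"
| "Ck_on (Suc k) f S \<longleftrightarrow>
     (\<forall>x\<in>S. f differentiable (at x)) \<and> (\<forall>w. Ck_on k (\<lambda>x. frechet_derivative f (at x) w) S)"

definition smooth_on :: "('a::real_normed_vector \<Rightarrow> 'b::real_normed_vector) \<Rightarrow> 'a set \<Rightarrow> bool" where
  "smooth_on f S \<longleftrightarrow> (\<forall>k. Ck_on k f S)"

text \<open>
  In the linear coordinates given by a basis \<open>B\<close>, coordinates are indexed by the basis vectors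
  themselves, and the partial derivative for the index \<open>b\<close> is the derivative in direction \<open>b\<close>.
\<close>

definition partial_deriv :: "'a::real_vector \<Rightarrow> ('a \<Rightarrow> real) \<Rightarrow> 'a \<Rightarrow> real" where
  "partial_deriv b f u = deriv (\<lambda>t. f (u + t *\<^sub>R b)) 0"

definition hessian :: "('a::real_vector \<Rightarrow> real) \<Rightarrow> 'a \<Rightarrow> 'a \<Rightarrow> 'a \<Rightarrow> real" where
  "hessian f u a b = partial_deriv a (partial_deriv b f) u"

definition pos_def_matrix :: "'i set \<Rightarrow> ('i \<Rightarrow> 'i \<Rightarrow> real) \<Rightarrow> bool" where
  "pos_def_matrix I H \<longleftrightarrow>
     (\<forall>a\<in>I. \<forall>b\<in>I. H a b = H b a) \<and>
     (\<forall>\<xi>. (\<exists>a\<in>I. \<xi> a \<noteq> 0) \<longrightarrow> (\<Sum>a\<in>I. \<Sum>b\<in>I. H a b * \<xi> a * \<xi> b) > 0)"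

definition minkowski_norm :: "('a::real_normed_vector \<Rightarrow> real) \<Rightarrow> bool" where
  "minkowski_norm F \<longleftrightarrow>
     (\<forall>u. F u \<ge> 0) \<and>
     smooth_on F (- {0}) \<and>
     F 0 = 0 \<and>
     (\<forall>u. \<forall>c>0. F (c *\<^sub>R u) = c * F u) \<and>
     (\<forall>B. is_basis B \<longrightarrow>
        (\<forall>u. u \<noteq> 0 \<longrightarrow> pos_def_matrix B (hessian (\<lambda>x. 1/2 * (F x)\<^sup>2) u)))"

definition closed_unit_ball :: "('a \<Rightarrow> real) \<Rightarrow> 'a set" where
  "closed_unit_ball F = {u. F u \<le> 1}"

definition minkowski_submersion ::
  "('a::real_normed_vector \<Rightarrow> real) \<Rightarrow> ('b::real_normed_vector \<Rightarrow> real) \<Rightarrow> ('a \<Rightarrow> 'b) \<Rightarrow> bool" where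
  "minkowski_submersion F1 F2 \<mu> \<longleftrightarrow>
     linear \<mu> \<and> surj \<mu> \<and> \<mu> ` closed_unit_ball F1 = closed_unit_ball F2"

definition nonlinear_lift ::
  "('a::real_normed_vector \<Rightarrow> 'b::real_normed_vector) \<Rightarrow> ('b \<Rightarrow> 'a) \<Rightarrow> bool" where
  "nonlinear_lift \<mu> h \<longleftrightarrow> continuous_on UNIV h \<and> smooth_on h (- {0}) \<and> \<mu> \<circ> h = id"

definition homogeneous_map :: "('b::real_vector \<Rightarrow> 'a::real_vector) \<Rightarrow> bool" where
  "homogeneous_map h \<longleftrightarrow> (\<forall>c>0. \<forall>v. h (c *\<^sub>R v) = c *\<^sub>R h v)"

definition induced_lift :: "('a \<Rightarrow> real) \<Rightarrow> ('a \<Rightarrow> 'b) \<Rightarrow> ('b \<Rightarrow> 'a) \<Rightarrow> bool" where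
  "induced_lift F1 \<mu> h \<longleftrightarrow>
     (\<forall>v. {u. is_arg_min F1 (\<lambda>x. x \<in> \<mu> -` {v}) u} = {h v})"

definition induced_homogeneous_nonlinear_lift ::
  "('a::real_normed_vector \<Rightarrow> real) \<Rightarrow> ('a \<Rightarrow> 'b::real_normed_vector) \<Rightarrow> ('b \<Rightarrow> 'a) \<Rightarrow> bool" where
  "induced_homogeneous_nonlinear_lift F1 \<mu> h \<longleftrightarrow>
     nonlinear_lift \<mu> h \<and> homogeneous_map h \<and> induced_lift F1 \<mu> h"

definition subduced_norm :: "('a \<Rightarrow> real) \<Rightarrow> ('a \<Rightarrow> 'b) \<Rightarrow> 'b \<Rightarrow> real" where
  "subduced_norm F1 \<mu> v = Inf {F1 u |u. \<mu> u = v}"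

end

theory Submission
  imports Defs
begin

text \<open>
  Write \<open>E = F\<^sup>2/2\<close>. Since \<open>F\<close> is positive and proper, it attains its minimum on every fibre of
  \<open>\<mu>\<close>; strong convexity along the line through two minimisers makes the minimiser \<open>h v\<close> unique, and
  compactness then makes \<open>h\<close> continuous. At \<open>h v \<noteq> 0\<close> the differential of \<open>E\<close> kills \<open>ker \<mu>\<close>. Let
  \<open>A u\<close> be the right inverse of \<open>\<mu>\<close> whose range is orthogonal to \<open>ker \<mu>\<close> for the Hessian of \<open>E\<close> at
  \<open>u\<close>. It depends smoothly on \<open>u\<close> by Gram--Schmidt. The argument of the inverse function theorem
  shows that \<open>h\<close> has derivative \<open>A (h v)\<close> at \<open>v\<close>, so \<open>h\<close> solves a differential equation with smooth
  right-hand side and is smooth by bootstrapping. The Hessian of \<open>E \<circ> h\<close> at \<open>v\<close> is the pullback by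
  \<open>A (h v)\<close> of the Hessian of \<open>E\<close> at \<open>h v\<close>, whence \<open>F \<circ> h\<close> is a Minkowski norm. Its unit ball is
  the image of that of \<open>F\<close>, and by homogeneity the unit ball determines the norm.
\<close>

subsection \<open>Finite-dimensional normed spaces\<close>

text \<open>Tychonoff. The type carries no Euclidean structure, so boxes of coefficient functions
  serve as the compact sets from which compactness is transported.\<close>

lemma compact_PiE_UNIV:
  fixes S :: "'i \<Rightarrow> real set"
  assumes "\<And>i. compact (S i)"
  shows "compact (PiE UNIV S)"
proof -
  have "compactin (product_topology (\<lambda>i. euclidean) UNIV) (PiE UNIV S)"
    using assms by (simp add: compactin_PiE)
  then show ?thesis
    by (simp add: euclidean_product_topology)
qed

text \<open>Continuity of the coordinates is the point: the norm of a linear combination has a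
  positive minimum on the compact set of coefficients of maximum norm 1, and scaling bounds every
  coordinate by a multiple of \<open>norm x\<close>.\<close>

lemma coordinates_exist:
  assumes "finite_dimensional TYPE('a::real_normed_vector)"
  obtains B :: "'a::real_normed_vector set" and c :: "'a::real_normed_vector \<Rightarrow> 'a::real_normed_vector \<Rightarrow> real"
  where "finite B" "is_basis B" "\<And>b. b \<in> B \<Longrightarrow> bounded_linear (c b)"
    "\<And>x. (\<Sum>b\<in>B. c b x *\<^sub>R b) = x"
proof -
  obtain T :: "'a set" where T: "finite T" "span T = UNIV"
    using assms unfolding finite_dimensional_def by blast
  obtain B :: "'a set" where ind: "independent B" and sp: "span B = UNIV"
    using real_vector.maximal_independent_subset[of UNIV] by (metis top.extremum_uniqueI)
  have fin: "finite B"
    using real_vector.independent_span_bound[OF T(1) ind] T(2) by auto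
  define c where "c b x = real_vector.representation B x b" for b x :: 'a
  have c: "(\<Sum>b\<in>B. c b x *\<^sub>R b) = x" for x
    unfolding c_def using real_vector.sum_representation_eq[OF ind, of x B] fin sp by simp
  have add: "c b (x + y) = c b x + c b y" for b x y
    unfolding c_def using real_vector.representation_add[OF ind] sp by simp
  have scale: "c b (r *\<^sub>R x) = r * c b x" for b r x
    unfolding c_def using real_vector.representation_scale[OF ind] sp by simp
  define L where "L \<xi> = (\<Sum>b\<in>B. \<xi> b *\<^sub>R b)" for \<xi> :: "'a \<Rightarrow> real"
  have contL: "continuous_on A L" for A
    unfolding L_def by (intro continuous_intros continuous_on_product_coordinates)
      (auto intro: continuous_on_subset[OF continuous_on_product_coordinates])
  \<comment> \<open>Coefficients off \<open>B\<close> are pinned to 0, so that \<open>Q\<close> is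
    compact in the space of all functions on the type. \<open>S\<close> is the unit sphere of the
    maximum norm; it is empty if \<open>B\<close> is, which is dimension 0 and treated
    apart.\<close>
  define Q where "Q = PiE UNIV (\<lambda>b. if b \<in> B then {-1..1::real} else {0})"
  define S where "S = Q \<inter> (\<Union>b\<in>B. {\<xi>. \<bar>\<xi> b\<bar> = 1})"
  have "compact Q"
    unfolding Q_def by (rule compact_PiE_UNIV) auto
  moreover have "closed {\<xi> :: 'a \<Rightarrow> real. \<bar>\<xi> b\<bar> = 1}" for b :: 'a
    by (intro closed_Collect_eq continuous_intros continuous_on_product_coordinates)
  ultimately have compS: "compact S"
    unfolding S_def using fin by (intro compact_Int_closed closed_UN) auto
  have nz: "L \<xi> \<noteq> 0" if "\<xi> \<in> S" for \<xi>
    using that real_vector.independentD[OF ind fin order.refl, of \<xi>]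
    unfolding S_def L_def by force
  have "\<exists>m>0. \<forall>x. \<forall>b\<in>B. m * \<bar>c b x\<bar> \<le> norm x"
  proof (cases "B = {}")
    case True
    then show ?thesis by (auto intro: exI[of _ 1])
  next
    case False
    then obtain b0 where b0: "b0 \<in> B" by auto
    then have "(\<lambda>b. if b = b0 then 1 else 0) \<in> S"
      unfolding S_def Q_def by auto
    then have "S \<noteq> {}" by auto
    have "continuous_on S (\<lambda>\<xi>. norm (L \<xi>))"
      using contL by (intro continuous_intros)
    then obtain \<xi>0 where \<xi>0: "\<xi>0 \<in> S" "\<And>\<xi>. \<xi> \<in> S \<Longrightarrow> norm (L \<xi>0) \<le> norm (L \<xi>)"
      using continuous_attains_inf[OF compS \<open>S \<noteq> {}\<close>] by blast
    have "norm (L \<xi>0) * \<bar>c b x\<bar> \<le> norm x" if "b \<in> B" for b x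
    proof -
      \<comment> \<open>The maximum norm of the coordinates of \<open>x\<close>; dividing by it
        moves them into \<open>S\<close>.\<close>
      define M where "M = Max ((\<lambda>b. \<bar>c b x\<bar>) ` B)"
      have M: "\<bar>c b x\<bar> \<le> M" if "b \<in> B" for b
        unfolding M_def using fin that by simp
      have "M \<in> (\<lambda>b. \<bar>c b x\<bar>) ` B"
        unfolding M_def using fin False by (intro Max_in) auto
      then obtain b1 where b1: "b1 \<in> B" "M = \<bar>c b1 x\<bar>" by auto
      show ?thesis
      proof (cases "M = 0")
        case True
        then show ?thesis using M[OF that] by simp
      next
        case False
        then have "M > 0" using b1 by simp
        define \<xi> where "\<xi> b = (if b \<in> B then c b x / M else 0)" for b
        have "\<xi> \<in> S"
        proof -
          have le: "\<bar>c b x / M\<bar> \<le> 1" if "b \<in> B" for b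
            using M[OF that] \<open>M > 0\<close> by simp
          have "\<bar>\<xi> b1\<bar> = 1"
            using b1 \<open>M > 0\<close> by (simp add: \<xi>_def)
          moreover have "\<xi> \<in> Q"
            unfolding Q_def \<xi>_def using le[unfolded abs_le_iff] by (auto simp: minus_le_iff PiE_UNIV_domain)
          ultimately show ?thesis
            unfolding S_def using b1(1) by blast
        qed
        have "L \<xi> = (1 / M) *\<^sub>R (\<Sum>b\<in>B. c b x *\<^sub>R b)"
          unfolding L_def \<xi>_def scaleR_sum_right by (intro sum.cong) auto
        then have "norm (L \<xi>) = norm x / M"
          using c \<open>M > 0\<close> by simp
        with \<xi>0(2)[OF \<open>\<xi> \<in> S\<close>] \<open>M > 0\<close> have "norm (L \<xi>0) * M \<le> norm x"
          by (simp add: field_simps)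
        with mult_left_mono[OF M[OF that], of "norm (L \<xi>0)"] show ?thesis by simp
      qed
    qed
    then show ?thesis using nz[OF \<xi>0(1)] by (intro exI[of _ "norm (L \<xi>0)"]) auto
  qed
  then obtain m where m: "m > 0" "\<And>x b. b \<in> B \<Longrightarrow> m * \<bar>c b x\<bar> \<le> norm x" by blast
  have "bounded_linear (c b)" if "b \<in> B" for b
  proof (rule bounded_linear_intro[where K = "1 / m"])
    show "norm (c b x) \<le> norm x * (1 / m)" for x
      using m(2)[OF that, of x] m(1) by (simp add: field_simps)
  qed (simp_all add: add scale)
  moreover have "is_basis B"
    using ind sp by (simp add: is_basis_def)
  ultimately show thesis
    using that[of B c] fin c by simp
qed

lemma finite_basis:
  assumes "finite_dimensional TYPE('a::real_vector)" "is_basis (B :: 'a::real_vector set)"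
  shows "finite B"
proof -
  obtain T :: "'a set" where "finite T" "span T = UNIV"
    using assms(1) unfolding finite_dimensional_def by blast
  then show ?thesis
    using real_vector.independent_span_bound[of T B] assms(2) by (simp add: is_basis_def)
qed

text \<open>Expansion in a basis makes \<open>f\<close> a finite sum of continuous coordinate
  functionals times constant vectors.\<close>

lemma finite_dimensional_bounded_linear:
  fixes f :: "'a::real_normed_vector \<Rightarrow> 'b::real_normed_vector"
  assumes "finite_dimensional TYPE('a)" "linear f"
  shows "bounded_linear f"
proof -
  obtain B :: "'a set" and c where B: "finite B" "is_basis B" "\<And>b. b \<in> B \<Longrightarrow> bounded_linear (c b)"
    "\<And>x. (\<Sum>b\<in>B. c b x *\<^sub>R b) = x"
    by (rule coordinates_exist[OF assms(1)]) (rule that)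
  have eq: "f = (\<lambda>x. \<Sum>b\<in>B. c b x *\<^sub>R f b)"
  proof
    fix x
    have "f x = f (\<Sum>b\<in>B. c b x *\<^sub>R b)" by (simp only: B(4))
    also have "\<dots> = (\<Sum>b\<in>B. c b x *\<^sub>R f b)"
      using assms(2) by (simp add: linear_sum linear_cmul)
    finally show "f x = (\<Sum>b\<in>B. c b x *\<^sub>R f b)" .
  qed
  show ?thesis
    by (subst eq) (use B(3) in \<open>intro bounded_linear_sum bounded_linear_scaleR_const\<close>)
qed

text \<open>Bounded coordinates place \<open>S\<close> inside the continuous image of a compact box
  of coefficients, and \<open>S\<close> is closed.\<close>

lemma finite_dimensional_compact:
  fixes S :: "'a::real_normed_vector set"
  assumes "finite_dimensional TYPE('a)" "closed S" "bounded S"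
  shows "compact S"
proof -
  obtain B :: "'a set" and c where B: "finite B" "is_basis B" "\<And>b. b \<in> B \<Longrightarrow> bounded_linear (c b)"
    "\<And>x. (\<Sum>b\<in>B. c b x *\<^sub>R b) = x"
    by (rule coordinates_exist[OF assms(1)]) (rule that)
  define L where "L \<xi> = (\<Sum>b\<in>B. \<xi> b *\<^sub>R b)" for \<xi> :: "'a \<Rightarrow> real"
  have contL: "continuous_on A L" for A
    unfolding L_def by (intro continuous_intros)
      (auto intro: continuous_on_subset[OF continuous_on_product_coordinates])
  have "\<exists>r. \<forall>x\<in>S. \<bar>c b x\<bar> \<le> r" if "b \<in> B" for b
  proof -
    have "bounded (c b ` S)"
      using bounded_linear_image[OF assms(3) B(3)[OF that]] .
    then show ?thesis by (auto simp: bounded_iff)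
  qed
  then obtain r where r: "\<And>b x. b \<in> B \<Longrightarrow> x \<in> S \<Longrightarrow> \<bar>c b x\<bar> \<le> r b" by metis
  define Q where "Q = PiE UNIV (\<lambda>b. if b \<in> B then {-r b..r b} else {0})"
  have "compact Q"
    unfolding Q_def by (rule compact_PiE_UNIV) auto
  then have "compact (L ` Q)"
    using contL by (rule compact_continuous_image[rotated])
  moreover have "S \<subseteq> L ` Q"
  proof
    fix x assume "x \<in> S"
    define \<xi> where "\<xi> b = (if b \<in> B then c b x else 0)" for b
    have "L \<xi> = x"
      using B(4)[of x] by (simp add: L_def \<xi>_def)
    moreover have "\<xi> \<in> Q"
      unfolding Q_def \<xi>_def using r[OF _ \<open>x \<in> S\<close>] by (simp add: abs_le_iff minus_le_iff PiE_UNIV_domain)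
    ultimately show "x \<in> L ` Q" by blast
  qed
  ultimately show ?thesis
    using closed_Int_compact[OF assms(2), of "L ` Q"] by (simp add: inf.absorb1)
qed

subsection \<open>Continuously differentiable functions\<close>

text \<open>Openness of \<open>S\<close> makes derivatives at its points depend only on values in
  \<open>S\<close>, so the induction passes to the derivatives.\<close>

lemma Ck_on_cong:
  assumes "open S" "\<And>x. x \<in> S \<Longrightarrow> f x = g x"
  shows "Ck_on k f S \<longleftrightarrow> Ck_on k g S"
proof -
  have "Ck_on k g S" if "Ck_on k f S" "\<And>x. x \<in> S \<Longrightarrow> f x = g x" for f g
    using that
  proof (induction k arbitrary: f g)
    case 0
    then show ?case by (simp cong: continuous_on_cong)
  next
    case (Suc k)
    have D: "(g has_derivative frechet_derivative f (at x)) (at x)" if "x \<in> S" for x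
      using Suc.prems that frechet_derivative_works has_derivative_transform_within_open[OF _ assms(1) that]
      by (metis Ck_on.simps(2))
    then have "frechet_derivative f (at x) = frechet_derivative g (at x)" if "x \<in> S" for x
      using frechet_derivative_at that by blast
    then have "Ck_on k (\<lambda>x. frechet_derivative g (at x) w) S" for w
      using Suc.IH[of "\<lambda>x. frechet_derivative f (at x) w"] Suc.prems(1) by simp
    with D show ?case
      by (auto simp: differentiable_def)
  qed
  from this[of f g] this[of g f] show ?thesis
    using assms(2) by auto
qed

text \<open>Allows any explicit derivative in place of the chosen \<open>frechet_derivative\<close>;
  the inductive steps of the closure rules below rest on it.\<close>

lemma Ck_on_SucI:
  assumes "open S" "\<And>x. x \<in> S \<Longrightarrow> (f has_derivative f' x) (at x)"
    and "\<And>w. Ck_on k (\<lambda>x. f' x w) S"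
  shows "Ck_on (Suc k) f S"
proof -
  have "frechet_derivative f (at x) = f' x" if "x \<in> S" for x
    using frechet_derivative_at assms(2) that by metis
  then have "Ck_on k (\<lambda>x. frechet_derivative f (at x) w) S" for w
    using Ck_on_cong[OF assms(1), of "\<lambda>x. frechet_derivative f (at x) w" "\<lambda>x. f' x w"] assms(3)
    by simp
  with assms(2) show ?thesis
    by (auto simp: differentiable_def)
qed

lemma Ck_on_SucD:
  assumes "Ck_on (Suc k) f S"
  shows "x \<in> S \<Longrightarrow> (f has_derivative frechet_derivative f (at x)) (at x)"
    and "Ck_on k (\<lambda>x. frechet_derivative f (at x) w) S"
  using assms by (auto simp: frechet_derivative_works)

lemma Ck_on_decrease: "Ck_on (Suc k) f S \<Longrightarrow> Ck_on k f S"
proof (induction k arbitrary: f)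
  case 0
  then have "f differentiable (at x)" if "x \<in> S" for x
    using that by simp
  then show ?case
    by (simp add: continuous_at_imp_continuous_on differentiable_imp_continuous_within)
next
  case (Suc k)
  then show ?case by (metis Ck_on.simps(2))
qed

lemma Ck_on_imp_continuous_on: "Ck_on k f S \<Longrightarrow> continuous_on S f"
  by (induction k) (auto dest: Ck_on_decrease simp del: Ck_on.simps(2))

lemma Ck_on_const: "Ck_on k (\<lambda>x. a) S"
  by (induction k arbitrary: a) auto

lemma Ck_on_bounded_linear:
  assumes "open S" "bounded_linear L" "Ck_on k f S"
  shows "Ck_on k (\<lambda>x. L (f x)) S"
  using assms(3)
proof (induction k arbitrary: f)
  case 0
  then show ?case
    using assms(2) by (simp add: bounded_linear.continuous_on)
next
  case (Suc k)
  show ?case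
    by (rule Ck_on_SucI[OF assms(1) bounded_linear.has_derivative[OF assms(2) Ck_on_SucD(1)[OF Suc.prems]]])
      (auto intro: Suc.IH Ck_on_SucD(2)[OF Suc.prems])
qed

lemma Ck_on_add:
  assumes "open S" "Ck_on k f S" "Ck_on k g S"
  shows "Ck_on k (\<lambda>x. f x + g x) S"
  using assms(2,3)
proof (induction k arbitrary: f g)
  case 0
  then show ?case by (simp add: continuous_on_add)
next
  case (Suc k)
  show ?case
    by (rule Ck_on_SucI[OF assms(1) has_derivative_add[OF Ck_on_SucD(1)[OF Suc.prems(1)] Ck_on_SucD(1)[OF Suc.prems(2)]]])
      (auto intro: Suc.IH Ck_on_SucD(2)[OF Suc.prems(1)] Ck_on_SucD(2)[OF Suc.prems(2)])
qed

lemma Ck_on_sum: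
  assumes "open S" "\<And>i. i \<in> I \<Longrightarrow> Ck_on k (f i) S"
  shows "Ck_on k (\<lambda>x. \<Sum>i\<in>I. f i x) S"
  using assms(2)
  by (induction I rule: infinite_finite_induct) (auto intro: Ck_on_const Ck_on_add assms(1))

text \<open>By the product rule each summand pairs a derivative with an undifferentiated factor, so
  the induction also uses that \<open>f\<close> and \<open>g\<close> themselves have the lower
  order.\<close>

lemma Ck_on_bounded_bilinear:
  assumes "open S" "bounded_bilinear p" "Ck_on k f S" "Ck_on k g S"
  shows "Ck_on k (\<lambda>x. p (f x) (g x)) S"
  using assms(3,4)
proof (induction k arbitrary: f g)
  case 0
  then show ?case
    using bounded_bilinear.continuous_on[OF assms(2)] by simp
next
  case (Suc k)
  show ?case
    by (rule Ck_on_SucI[OF assms(1) bounded_bilinear.FDERIV[OF assms(2) Ck_on_SucD(1)[OF Suc.prems(1)] Ck_on_SucD(1)[OF Suc.prems(2)]]])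
      (auto intro!: Suc.IH Ck_on_add assms(1) Ck_on_SucD(2)[OF Suc.prems(1)] Ck_on_SucD(2)[OF Suc.prems(2)]
        Ck_on_decrease[OF Suc.prems(1)] Ck_on_decrease[OF Suc.prems(2)])
qed

lemmas Ck_on_scaleR = Ck_on_bounded_bilinear[OF _ bounded_bilinear_scaleR]
lemmas Ck_on_mult = Ck_on_bounded_bilinear[OF _ bounded_bilinear_mult]

lemma Ck_on_diff:
  assumes "open S" "Ck_on k f S" "Ck_on k g S"
  shows "Ck_on k (\<lambda>x. f x - g x) S"
  using Ck_on_add[OF assms(1,2) Ck_on_bounded_linear[OF assms(1) bounded_linear_minus[OF bounded_linear_ident] assms(3)]]
  by simp

text \<open>The derivative contains \<open>inverse (f x)\<close> again, which the induction
  hypothesis covers at the lower order.\<close>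

lemma Ck_on_inverse:
  fixes f :: "'a::real_normed_vector \<Rightarrow> real"
  assumes "open S" "Ck_on k f S" "\<And>x. x \<in> S \<Longrightarrow> f x \<noteq> 0"
  shows "Ck_on k (\<lambda>x. inverse (f x)) S"
  using assms(2)
proof (induction k)
  case 0
  then show ?case using assms(3) by (simp add: continuous_on_inverse)
next
  case (Suc k)
  have inv: "Ck_on k (\<lambda>x. inverse (f x)) S"
    using Suc.IH[OF Ck_on_decrease[OF Suc.prems]] .
  have "Ck_on k (\<lambda>x. - (inverse (f x) * frechet_derivative f (at x) w * inverse (f x))) S" for w
    by (intro Ck_on_bounded_linear[OF assms(1) bounded_linear_minus[OF bounded_linear_ident]]
      Ck_on_mult assms(1) inv Ck_on_SucD(2)[OF Suc.prems])
  then show ?case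
    by (intro Ck_on_SucI[OF assms(1) Deriv.has_derivative_inverse[OF assms(3) Ck_on_SucD(1)[OF Suc.prems]]])
qed

text \<open>In the chain rule the direction fed to the derivative of \<open>g\<close> varies with
  \<open>x\<close>, while \<open>Ck_on\<close> speaks of fixed directions. Expanding that direction
  in a basis leaves derivatives of \<open>g\<close> in fixed directions \<open>b\<close>, to which
  the induction hypothesis applies.\<close>

lemma Ck_on_compose:
  fixes f :: "'a::real_normed_vector \<Rightarrow> 'b::real_normed_vector"
  assumes fd: "finite_dimensional TYPE('b)" and "open S" "open T"
    and "f ` S \<subseteq> T" "Ck_on k f S" "Ck_on k g T"
  shows "Ck_on k (\<lambda>x. g (f x)) S"
  using assms(5,6)
proof (induction k arbitrary: g)
  case 0
  then show ?case
    using assms(4) continuous_on_compose2 by auto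
next
  case (Suc k)
  obtain B :: "'b set" and c where B: "finite B" "is_basis B" "\<And>b. b \<in> B \<Longrightarrow> bounded_linear (c b)"
    "\<And>x. (\<Sum>b\<in>B. c b x *\<^sub>R b) = x"
    by (rule coordinates_exist[OF fd]) (rule that)
  let ?f' = "\<lambda>x. frechet_derivative f (at x)" and ?g' = "\<lambda>y. frechet_derivative g (at y)"
  have D: "((\<lambda>x. g (f x)) has_derivative (\<lambda>w. \<Sum>b\<in>B. c b (?f' x w) *\<^sub>R ?g' (f x) b)) (at x)"
    if "x \<in> S" for x
  proof -
    have g': "(g has_derivative ?g' (f x)) (at (f x))"
      using Ck_on_SucD(1)[OF Suc.prems(2)] assms(4) that by auto
    then have lin: "linear (?g' (f x))"
      by (rule has_derivative_linear)
    have eq: "(\<Sum>b\<in>B. c b z *\<^sub>R ?g' (f x) b) = ?g' (f x) z" for z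
      using linear_sum[OF lin, of "\<lambda>b. c b z *\<^sub>R b" B] linear_cmul[OF lin] by (simp add: B(4))
    show ?thesis
      unfolding eq using has_derivative_compose[OF Ck_on_SucD(1)[OF Suc.prems(1) that] g'] .
  qed
  show ?case
    by (rule Ck_on_SucI[OF assms(2) D])
      (auto intro!: Ck_on_sum assms(2) Ck_on_scaleR Ck_on_bounded_linear[OF _ B(3)]
        Ck_on_SucD(2)[OF Suc.prems(1)] Suc.IH[OF Ck_on_decrease[OF Suc.prems(1)] Ck_on_SucD(2)[OF Suc.prems(2)]])
qed

subsection \<open>The Hessian\<close>

lemma has_derivative_along_line:
  assumes "(f has_derivative f') (at (u + t *\<^sub>R b))"
  shows "((\<lambda>t. f (u + t *\<^sub>R b)) has_real_derivative f' b) (at t)"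
proof -
  have "((\<lambda>t. u + t *\<^sub>R b) has_derivative (\<lambda>t. t *\<^sub>R b)) (at t)"
    by (auto intro!: derivative_eq_intros)
  from has_derivative_compose[OF this assms]
  have "((\<lambda>t. f (u + t *\<^sub>R b)) has_derivative (\<lambda>t. f' (t *\<^sub>R b))) (at t)" .
  moreover have "f' (t *\<^sub>R b) = f' b * t" for t
    using linear_cmul[OF has_derivative_linear[OF assms]] by (simp add: mult.commute)
  ultimately show ?thesis
    by (simp add: has_field_derivative_def)
qed

lemma partial_deriv_eq:
  assumes "(f has_derivative f') (at u)"
  shows "partial_deriv b f u = f' b"
  using has_derivative_along_line[of f f' u 0 b] assms
  unfolding partial_deriv_def by (auto intro: DERIV_imp_deriv)

text \<open>On \<open>S\<close> the coordinate notion \<open>partial_deriv b f\<close> agrees with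
  the directional derivative of \<open>f\<close>, and by openness the outer partial derivative is a
  directional derivative as well.\<close>

lemma hessian_has_derivative:
  assumes "open S" "u \<in> S" "Ck_on (Suc (Suc k)) f S"
  shows "((\<lambda>x. frechet_derivative f (at x) b) has_derivative (\<lambda>a. hessian f u a b)) (at u)"
proof -
  let ?g = "\<lambda>x. frechet_derivative f (at x) b"
  have D: "(?g has_derivative frechet_derivative ?g (at u)) (at u)"
    using Ck_on_SucD(1)[OF Ck_on_SucD(2)[OF assms(3)] assms(2)] .
  have "partial_deriv b f x = ?g x" if "x \<in> S" for x
    using partial_deriv_eq[OF Ck_on_SucD(1)[OF assms(3) that]] .
  then have "(partial_deriv b f has_derivative frechet_derivative ?g (at u)) (at u)"
    using has_derivative_transform_within_open[OF D assms(1,2)] by metis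
  then have "hessian f u a b = frechet_derivative ?g (at u) a" for a
    unfolding hessian_def by (rule partial_deriv_eq)
  with D show ?thesis by (simp add: eta_contract_eq)
qed

text \<open>Uniqueness of derivatives: any formula \<open>g\<close> for the first derivative in
  direction \<open>b\<close> may be differentiated instead.\<close>

lemma hessian_eqI:
  assumes "open S" "u \<in> S" "Ck_on (Suc (Suc k)) f S"
    and "\<And>x. x \<in> S \<Longrightarrow> frechet_derivative f (at x) b = g x" "(g has_derivative g') (at u)"
  shows "hessian f u a b = g' a"
proof -
  have "(g has_derivative (\<lambda>a. hessian f u a b)) (at u)"
    using has_derivative_transform_within_open[OF hessian_has_derivative[OF assms(1-3)] assms(1,2,4)] .
  from has_derivative_unique[OF this assms(5)] show ?thesis by metis
qed

lemma linear_hessian_left: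
  assumes "open S" "u \<in> S" "Ck_on (Suc (Suc k)) f S"
  shows "linear (\<lambda>a. hessian f u a b)"
  by (rule has_derivative_linear[OF hessian_has_derivative[OF assms]])

text \<open>The inner derivative is linear in its direction at every point of \<open>S\<close>, and
  differentiating preserves these identities.\<close>

lemma linear_hessian_right:
  assumes "open S" "u \<in> S" "Ck_on (Suc (Suc k)) f S"
  shows "linear (\<lambda>b. hessian f u a b)"
proof (rule linearI)
  have lin: "linear (frechet_derivative f (at x))" if "x \<in> S" for x
    by (rule has_derivative_linear[OF Ck_on_SucD(1)[OF assms(3) that]])
  note D = hessian_has_derivative[OF assms]
  show "hessian f u a (b + c) = hessian f u a b + hessian f u a c" for b c
    by (rule hessian_eqI[OF assms linear_add[OF lin] has_derivative_add[OF D D]])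
  show "hessian f u a (r *\<^sub>R b) = r *\<^sub>R hessian f u a b" for r b
    by (rule hessian_eqI[OF assms linear_cmul[OF lin] has_derivative_scaleR_right[OF D]])
qed

lemma Ck_on_hessian:
  assumes "open S" "Ck_on (Suc (Suc k)) f S"
  shows "Ck_on k (\<lambda>u. hessian f u a b) S"
proof -
  let ?g = "\<lambda>x. frechet_derivative f (at x) b"
  have "hessian f u a b = frechet_derivative ?g (at u) a" if "u \<in> S" for u
    using frechet_derivative_at[OF hessian_has_derivative[OF assms(1) that assms(2)]] by metis
  then show ?thesis
    using Ck_on_cong[OF assms(1), of "\<lambda>u. hessian f u a b" "\<lambda>u. frechet_derivative ?g (at u) a" k]
      Ck_on_SucD(2)[OF Ck_on_SucD(2)[OF assms(2)]] by simp
qed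

text \<open>Bilinear expansion trades the condition on coordinates for a basis-free one, which suits
  pullbacks of forms.\<close>

lemma pos_def_matrix_iff:
  assumes B: "finite B" "is_basis B"
    and lin: "\<And>b. linear (\<lambda>a. H a b)" "\<And>a. linear (\<lambda>b. H a b)"
  shows "pos_def_matrix B H \<longleftrightarrow> (\<forall>a b. H a b = H b a) \<and> (\<forall>a. a \<noteq> 0 \<longrightarrow> H a a > 0)"
proof -
  have expand: "H (\<Sum>a\<in>B. \<xi> a *\<^sub>R a) (\<Sum>b\<in>B. \<eta> b *\<^sub>R b) = (\<Sum>a\<in>B. \<Sum>b\<in>B. H a b * \<xi> a * \<eta> b)" for \<xi> \<eta>
    by (subst sum.swap) (simp add: linear_sum[OF lin(1)] linear_cmul[OF lin(1)]
      linear_sum[OF lin(2)] linear_cmul[OF lin(2)] sum_distrib_left mult_ac)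
  have coords: "\<exists>\<xi>. x = (\<Sum>b\<in>B. \<xi> b *\<^sub>R b)" for x
    using B real_vector.span_finite[OF B(1)] unfolding is_basis_def by blast
  have nz: "(\<Sum>b\<in>B. \<xi> b *\<^sub>R b) = 0 \<longleftrightarrow> (\<forall>b\<in>B. \<xi> b = 0)" for \<xi>
  proof
    assume "(\<Sum>b\<in>B. \<xi> b *\<^sub>R b) = 0"
    then show "\<forall>b\<in>B. \<xi> b = 0"
      using real_vector.independentD[OF _ B(1) order.refl, of \<xi>] B(2) unfolding is_basis_def by blast
  qed simp
  show ?thesis
  proof
    assume pd: "pos_def_matrix B H"
    have "H x y = H y x" for x y
    proof -
      obtain \<xi> \<eta> where xy: "x = (\<Sum>b\<in>B. \<xi> b *\<^sub>R b)" "y = (\<Sum>b\<in>B. \<eta> b *\<^sub>R b)"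
        using coords by metis
      have "H x y = (\<Sum>b\<in>B. \<Sum>a\<in>B. H a b * \<xi> a * \<eta> b)"
        unfolding xy expand by (rule sum.swap)
      also have "\<dots> = H y x"
        unfolding xy expand using pd unfolding pos_def_matrix_def
        by (intro sum.cong refl) (simp add: mult_ac)
      finally show ?thesis .
    qed
    moreover have "H x x > 0" if "x \<noteq> 0" for x
    proof -
      obtain \<xi> where x: "x = (\<Sum>b\<in>B. \<xi> b *\<^sub>R b)"
        using coords by metis
      with that nz[of \<xi>] have "\<exists>b\<in>B. \<xi> b \<noteq> 0" by simp
      then show ?thesis
        using pd unfolding x expand pos_def_matrix_def by blast
    qed
    ultimately show "(\<forall>a b. H a b = H b a) \<and> (\<forall>a. a \<noteq> 0 \<longrightarrow> H a a > 0)" by blast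
  next
    assume H: "(\<forall>a b. H a b = H b a) \<and> (\<forall>a. a \<noteq> 0 \<longrightarrow> H a a > 0)"
    have "(\<Sum>b\<in>B. \<xi> b *\<^sub>R b) \<noteq> 0" if "\<exists>b\<in>B. \<xi> b \<noteq> 0" for \<xi>
      using that nz by blast
    with H show "pos_def_matrix B H"
      unfolding pos_def_matrix_def expand[symmetric] by simp
  qed
qed

text \<open>The hypothesis controls \<open>H\<close> for fixed arguments only; expanding both
  arguments in a basis moves their dependence on \<open>u\<close> into scalar factors.\<close>

lemma Ck_on_bilinear_family:
  fixes a b :: "'x::real_normed_vector \<Rightarrow> 'a::real_normed_vector"
  assumes "finite_dimensional TYPE('a)" "open U"
    and lin: "\<And>u y. u \<in> U \<Longrightarrow> linear (\<lambda>x. H u x y)" "\<And>u x. u \<in> U \<Longrightarrow> linear (\<lambda>y. H u x y)"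
    and H: "\<And>x y. Ck_on k (\<lambda>u. H u x y :: real) U"
    and ab: "Ck_on k a U" "Ck_on k b U"
  shows "Ck_on k (\<lambda>u. H u (a u) (b u)) U"
proof -
  obtain B :: "'a set" and c where B: "finite B" "is_basis B" "\<And>b. b \<in> B \<Longrightarrow> bounded_linear (c b)"
    "\<And>x. (\<Sum>b\<in>B. c b x *\<^sub>R b) = x"
    by (rule coordinates_exist[OF assms(1)]) (rule that)
  have "H u x y = (\<Sum>i\<in>B. \<Sum>j\<in>B. c i x * (c j y * H u i j))" if "u \<in> U" for u x y
  proof -
    have "H u x y = H u (\<Sum>b\<in>B. c b x *\<^sub>R b) (\<Sum>b\<in>B. c b y *\<^sub>R b)"
      by (simp only: B(4))
    also have "\<dots> = (\<Sum>i\<in>B. \<Sum>j\<in>B. c i x * (c j y * H u i j))"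
      by (subst sum.swap) (simp add: linear_sum[OF lin(1)[OF that]] linear_cmul[OF lin(1)[OF that]]
        linear_sum[OF lin(2)[OF that]] linear_cmul[OF lin(2)[OF that]] sum_distrib_left mult_ac)
    finally show ?thesis .
  qed
  then have "Ck_on k (\<lambda>u. H u (a u) (b u)) U \<longleftrightarrow>
    Ck_on k (\<lambda>u. \<Sum>i\<in>B. \<Sum>j\<in>B. c i (a u) * (c j (b u) * H u i j)) U"
    by (intro Ck_on_cong assms(2)) blast
  also have \<dots>
    by (intro Ck_on_sum Ck_on_mult Ck_on_bounded_linear[OF _ B(3)] assms(2) ab H)
  finally show ?thesis .
qed

text \<open>Gram--Schmidt with parameters: only rational operations occur, so smoothness is preserved.\<close>

lemma smooth_dual_basis:
  fixes H :: "'x::real_normed_vector \<Rightarrow> 'a::real_normed_vector \<Rightarrow> 'a \<Rightarrow> real"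
  assumes fd: "finite_dimensional TYPE('a)" and U: "open U"
    and lin: "\<And>u y. u \<in> U \<Longrightarrow> linear (\<lambda>x. H u x y)" "\<And>u x. u \<in> U \<Longrightarrow> linear (\<lambda>y. H u x y)"
    and pos: "\<And>u x. u \<in> U \<Longrightarrow> x \<noteq> 0 \<Longrightarrow> H u x x > 0"
    and H: "\<And>k x y. Ck_on k (\<lambda>u. H u x y) U"
    and S: "finite S" "independent S"
  obtains c where "\<And>k i. i \<in> S \<Longrightarrow> Ck_on k (\<lambda>u. c u i) U"
    and "\<And>u i. i \<in> S \<Longrightarrow> u \<in> U \<Longrightarrow> c u i \<in> span S"
    and "\<And>u i j. i \<in> S \<Longrightarrow> j \<in> S \<Longrightarrow> u \<in> U \<Longrightarrow> H u (c u i) j = (if i = j then 1 else 0)"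
proof -
  have "\<exists>c. \<forall>i\<in>S. (\<forall>k. Ck_on k (\<lambda>u. c u i) U) \<and>
    (\<forall>u\<in>U. c u i \<in> span S \<and> (\<forall>j\<in>S. H u (c u i) j = (if i = j then 1 else 0)))"
    using S
  proof (induction S)
    case empty
    then show ?case by simp
  next
    case (insert s S)
    then have "independent S" and s: "s \<notin> span S"
      by (auto simp: real_vector.independent_insert)
    with insert.IH obtain c where "\<forall>i\<in>S. (\<forall>k. Ck_on k (\<lambda>u. c u i) U) \<and>
      (\<forall>u\<in>U. c u i \<in> span S \<and> (\<forall>j\<in>S. H u (c u i) j = (if i = j then 1 else 0)))"
      by auto
    then have c: "i \<in> S \<Longrightarrow> Ck_on k (\<lambda>u. c u i) U"
      "i \<in> S \<Longrightarrow> u \<in> U \<Longrightarrow> c u i \<in> span S"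
      "i \<in> S \<Longrightarrow> j \<in> S \<Longrightarrow> u \<in> U \<Longrightarrow> H u (c u i) j = (if i = j then 1 else 0)" for u i j k
      by simp_all
    \<comment> \<open>The sum is the orthogonal projection of \<open>s\<close> to
      \<open>span S\<close>, read off from the old dual basis: it pairs with each \<open>j\<close>
      in \<open>S\<close> as \<open>s\<close> does.\<close>
    define e where "e u = s - (\<Sum>i\<in>S. H u s i *\<^sub>R c u i)" for u
    \<comment> \<open>The new dual vector is \<open>e u\<close>, normalised by its pairing with
      \<open>s\<close>. The old ones are corrected by a multiple of \<open>e u\<close> that kills
      their pairing with \<open>s\<close>; their pairings with \<open>S\<close> survive because
      \<open>e u\<close> is orthogonal to \<open>S\<close>.\<close>
    define d where "d u i = (if i = s then inverse (H u (e u) (e u)) *\<^sub>R e u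
      else c u i - (H u (c u i) s * inverse (H u (e u) (e u))) *\<^sub>R e u)" for u i
    have P: "(\<Sum>i\<in>S. H u s i *\<^sub>R c u i) \<in> span S" if "u \<in> U" for u
      using c(2) that by (intro span_sum span_scale) auto
    have e0: "e u \<noteq> 0" if "u \<in> U" for u
      using P[OF that] s by (auto simp: e_def)
    have eH: "H u (e u) (e u) > 0" if "u \<in> U" for u
      using pos[OF that e0[OF that]] .
    have e_orth: "H u (e u) j = 0" if "u \<in> U" "j \<in> S" for u j
    proof -
      have "H u (\<Sum>i\<in>S. H u s i *\<^sub>R c u i) j = (\<Sum>i\<in>S. H u s i * (if i = j then 1 else 0))"
        using that c(3) by (simp add: linear_sum[OF lin(1)] linear_cmul[OF lin(1)] cong: sum.cong)
      then show ?thesis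
        using that insert.hyps by (simp add: e_def linear_diff[OF lin(1)] if_distrib cong: if_cong)
    qed
    have e_span: "H u (e u) x = 0" if "u \<in> U" "x \<in> span S" for u x
      using that(2) e_orth[OF that(1)]
      by (induction rule: real_vector.span_induct_alt)
        (simp_all add: linear_0[OF lin(2)[OF that(1)]] linear_add[OF lin(2)[OF that(1)]] linear_cmul[OF lin(2)[OF that(1)]])
    \<comment> \<open>\<open>s\<close> and \<open>e u\<close> differ by an element of
      \<open>span S\<close>, to which \<open>e u\<close> is orthogonal.\<close>
    have e_s: "H u (e u) s = H u (e u) (e u)" if "u \<in> U" for u
    proof -
      have "s = e u + (\<Sum>i\<in>S. H u s i *\<^sub>R c u i)" by (simp add: e_def)
      then have "H u (e u) s = H u (e u) (e u + (\<Sum>i\<in>S. H u s i *\<^sub>R c u i))" by simp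
      then show ?thesis
        using e_span[OF that P[OF that]] by (simp only: linear_add[OF lin(2)[OF that]] add_0_right)
    qed
    have Ck_e: "Ck_on k e U" for k
      unfolding e_def by (intro Ck_on_diff Ck_on_sum Ck_on_scaleR Ck_on_const U H c(1))
    have Ck_inv: "Ck_on k (\<lambda>u. inverse (H u (e u) (e u))) U" for k
      using Ck_on_bilinear_family[OF fd U lin H Ck_e Ck_e] eH by (intro Ck_on_inverse U) force+
    have Ck_d: "Ck_on k (\<lambda>u. d u i) U" if "i \<in> insert s S" for i k
    proof (cases "i = s")
      case True
      then show ?thesis
        by (simp add: d_def Ck_on_scaleR U Ck_inv Ck_e)
    next
      case False
      then have "i \<in> S" using that by simp
      then have "Ck_on k (\<lambda>u. H u (c u i) s) U"
        by (intro Ck_on_bilinear_family[OF fd U lin H] c(1) Ck_on_const)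
      with False \<open>i \<in> S\<close> show ?thesis
        by (simp add: d_def Ck_on_diff Ck_on_mult Ck_on_scaleR U Ck_inv Ck_e c(1))
    qed
    have e_in: "e u \<in> span (insert s S)" if "u \<in> U" for u
      unfolding e_def using P[OF that] real_vector.span_mono[of S "insert s S"]
      by (intro span_diff) (auto intro: span_base)
    have d_in: "d u i \<in> span (insert s S)" if "i \<in> insert s S" "u \<in> U" for u i
      unfolding d_def using that e_in[OF that(2)] c(2) real_vector.span_mono[of S "insert s S"]
      by (auto intro!: span_diff span_scale)
    have "H u (d u i) j = (if i = j then 1 else 0)" if "i \<in> insert s S" "j \<in> insert s S" "u \<in> U" for u i j
      using that insert.hyps c(3) e_orth[OF that(3)] e_s[OF that(3)] eH[OF that(3)]
      by (auto simp: d_def linear_diff[OF lin(1)] linear_cmul[OF lin(1)])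
    with Ck_d d_in show ?case by (intro exI[of _ d]) simp
  qed
  then obtain c where "\<forall>i\<in>S. (\<forall>k. Ck_on k (\<lambda>u. c u i) U) \<and>
    (\<forall>u\<in>U. c u i \<in> span S \<and> (\<forall>j\<in>S. H u (c u i) j = (if i = j then 1 else 0)))" ..
  then show thesis by (intro that[of c]) simp_all
qed

subsection \<open>Minkowski norms\<close>

lemma open_Compl_zero: "open (- {0 :: 'a::real_normed_vector})"
  by (simp add: open_Compl)

locale minkowski_space =
  fixes F :: "'a::real_normed_vector \<Rightarrow> real"
  assumes finite_dimensional: "finite_dimensional TYPE('a)"
    and minkowski_norm: "minkowski_norm F"
begin

definition energy :: "'a \<Rightarrow> real" where
  "energy = (\<lambda>x. 1/2 * (F x)\<^sup>2)"

lemmas minkowski_conjs = minkowski_norm[unfolded minkowski_norm_def smooth_on_def]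

lemma nonneg: "F u \<ge> 0"
  by (rule minkowski_conjs[THEN conjunct1, THEN spec])

lemma Ck_F: "Ck_on k F (- {0})"
  by (rule minkowski_conjs[THEN conjunct2, THEN conjunct1, THEN spec])

lemma zero: "F 0 = 0"
  by (rule minkowski_conjs[THEN conjunct2, THEN conjunct2, THEN conjunct1])

lemma homogeneous: "c > 0 \<Longrightarrow> F (c *\<^sub>R u) = c * F u"
  by (rule minkowski_conjs[THEN conjunct2, THEN conjunct2, THEN conjunct2, THEN conjunct1, rule_format])

lemma pos_def_matrix_hessian: "is_basis B \<Longrightarrow> u \<noteq> 0 \<Longrightarrow> pos_def_matrix B (hessian (\<lambda>x. 1/2 * (F x)\<^sup>2) u)"
  by (rule minkowski_conjs[THEN conjunct2, THEN conjunct2, THEN conjunct2, THEN conjunct2, rule_format])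

lemma Ck_energy: "Ck_on k energy (- {0})"
  unfolding energy_def power2_eq_square
  by (rule Ck_on_mult[OF open_Compl_zero Ck_on_const Ck_on_mult[OF open_Compl_zero Ck_F Ck_F]])

lemma energy_has_derivative:
  "u \<noteq> 0 \<Longrightarrow> (energy has_derivative frechet_derivative energy (at u)) (at u)"
  by (rule Ck_on_SucD(1)[OF Ck_energy]) simp

lemma gradient_has_derivative:
  assumes "u \<noteq> 0"
  shows "((\<lambda>x. frechet_derivative energy (at x) b) has_derivative (\<lambda>a. hessian energy u a b)) (at u)"
  by (rule hessian_has_derivative[OF open_Compl_zero _ Ck_energy]) (use assms in simp)

lemma linear_hessian:
  assumes "u \<noteq> 0"
  shows "linear (\<lambda>a. hessian energy u a b)" "linear (\<lambda>b. hessian energy u a b)"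
  by (rule linear_hessian_left[OF open_Compl_zero _ Ck_energy]
      linear_hessian_right[OF open_Compl_zero _ Ck_energy], use assms in simp)+

lemma hessian_sym_pos:
  assumes "u \<noteq> 0"
  shows "hessian energy u a b = hessian energy u b a" "a \<noteq> 0 \<Longrightarrow> hessian energy u a a > 0"
proof -
  obtain B :: "'a set" and c where B: "finite B" "is_basis B" "\<And>b. b \<in> B \<Longrightarrow> bounded_linear (c b)"
    "\<And>x. (\<Sum>b\<in>B. c b x *\<^sub>R b) = x"
    by (rule coordinates_exist[OF finite_dimensional]) (rule that)
  have "pos_def_matrix B (hessian energy u)"
    unfolding energy_def by (rule pos_def_matrix_hessian[OF B(2) assms])
  then have "(\<forall>a b. hessian energy u a b = hessian energy u b a) \<and>
      (\<forall>a. a \<noteq> 0 \<longrightarrow> hessian energy u a a > 0)"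
    by (rule iffD1[OF pos_def_matrix_iff[OF B(1,2) linear_hessian[OF assms]]])
  then show "hessian energy u a b = hessian energy u b a" "a \<noteq> 0 \<Longrightarrow> hessian energy u a a > 0"
    by blast+
qed

lemma energy_derivative_along_line:
  assumes "u + t *\<^sub>R k \<noteq> 0"
  shows "((\<lambda>t. energy (u + t *\<^sub>R k)) has_real_derivative
      frechet_derivative energy (at (u + t *\<^sub>R k)) k) (at t)"
    and "((\<lambda>t. frechet_derivative energy (at (u + t *\<^sub>R k)) k) has_real_derivative
      hessian energy (u + t *\<^sub>R k) k k) (at t)"
  by (rule has_derivative_along_line[OF energy_has_derivative[OF assms]])
    (rule has_derivative_along_line[OF gradient_has_derivative[OF assms]])

text \<open>If \<open>F\<close> vanished at \<open>u\<close>, homogeneity would make the energy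
  vanish along the ray through \<open>u\<close>, and its second derivative there would contradict
  positive definiteness.\<close>

lemma pos:
  assumes "u \<noteq> 0"
  shows "F u > 0"
proof (rule ccontr)
  assume "\<not> F u > 0"
  then have "F u = 0" using nonneg[of u] by simp
  have ray: "u + t *\<^sub>R u = (1 + t) *\<^sub>R u" for t
    by (simp add: scaleR_add_left)
  \<comment> \<open>The range \<open>t > -1\<close> is open, contains 0 and keeps the point on the
    open ray through \<open>u\<close>, so the vanishing can be differentiated twice at 0.\<close>
  have eq0: "energy (u + t *\<^sub>R u) = 0" if "t \<in> {-1<..}" for t
    using that homogeneous[of "1 + t" u] \<open>F u = 0\<close> by (simp add: energy_def ray)
  have nz: "u + t *\<^sub>R u \<noteq> 0" if "t \<in> {-1<..}" for t
    using that assms by (simp add: ray)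
  have g0: "frechet_derivative energy (at (u + t *\<^sub>R u)) u = 0" if "t \<in> {-1<..}" for t
  proof (rule DERIV_unique)
    show "((\<lambda>t. energy (u + t *\<^sub>R u)) has_real_derivative
      frechet_derivative energy (at (u + t *\<^sub>R u)) u) (at t)"
      by (rule energy_derivative_along_line(1)[OF nz[OF that]])
    show "((\<lambda>t. energy (u + t *\<^sub>R u)) has_real_derivative 0) (at t)"
      by (rule has_field_derivative_transform_within_open[OF DERIV_const _ that]) (simp_all add: eq0)
  qed
  have "hessian energy (u + 0 *\<^sub>R u) u u = 0"
  proof (rule DERIV_unique)
    show "((\<lambda>t. frechet_derivative energy (at (u + t *\<^sub>R u)) u) has_real_derivative
      hessian energy (u + 0 *\<^sub>R u) u u) (at 0)"
      by (rule energy_derivative_along_line(2)) (use assms in simp)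
    show "((\<lambda>t. frechet_derivative energy (at (u + t *\<^sub>R u)) u) has_real_derivative 0) (at 0)"
      by (rule has_field_derivative_transform_within_open[OF DERIV_const, where S = "{-1<..}"])
        (simp_all add: g0)
  qed
  then show False
    using hessian_sym_pos(2)[OF assms assms] by simp
qed

text \<open>Extreme values of \<open>F\<close> on the compact unit sphere, extended by
  homogeneity.\<close>

lemma norm_bounds:
  obtains m M where "m > 0" "M > 0" "\<And>u. m * norm u \<le> F u" "\<And>u. F u \<le> M * norm u"
proof (cases "sphere (0::'a) 1 = {}")
  \<comment> \<open>An empty unit sphere means dimension 0, where any positive constants do.\<close>
  case True
  have all_zero: "u = 0" for u :: 'a
  proof (rule ccontr)
    assume "u \<noteq> 0"
    then have "sgn u \<in> sphere 0 1" by (simp add: norm_sgn)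
    with True show False by blast
  qed
  have "norm u = 0" "F u = 0" for u
    using all_zero[of u] zero by simp_all
  then show ?thesis
    by (intro that[of 1 1]) simp_all
next
  case False
  have "compact (sphere (0::'a) 1)"
  proof (rule finite_dimensional_compact[OF finite_dimensional])
    have "sphere (0::'a) 1 = {x. norm x = 1}"
      by auto
    then show "closed (sphere (0::'a) 1)"
      by (simp add: closed_Collect_eq continuous_on_norm_id)
    show "bounded (sphere (0::'a) 1)"
      by (auto simp: bounded_iff)
  qed
  moreover have "continuous_on (sphere 0 1) F"
    by (rule continuous_on_subset[OF Ck_on_imp_continuous_on[OF Ck_F]]) auto
  ultimately obtain a b where a: "a \<in> sphere 0 1" "\<And>u. u \<in> sphere 0 1 \<Longrightarrow> F a \<le> F u"
    and b: "b \<in> sphere 0 1" "\<And>u. u \<in> sphere 0 1 \<Longrightarrow> F u \<le> F b"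
    using continuous_attains_inf[OF _ False, of F] continuous_attains_sup[OF _ False, of F] by blast
  have F_eq: "F u = norm u * F (sgn u)" for u
  proof (cases "u = 0")
    case False
    then have "norm u *\<^sub>R sgn u = u"
      by (simp add: sgn_div_norm)
    with homogeneous[of "norm u" "sgn u"] False show ?thesis by simp
  qed (simp add: zero)
  have sgn_in: "sgn u \<in> sphere 0 1" if "u \<noteq> 0" for u :: 'a
    using that by (simp add: norm_sgn)
  have "F a * norm u \<le> F u \<and> F u \<le> F b * norm u" for u
  proof (cases "u = 0")
    case False
    then show ?thesis
      using mult_left_mono[OF a(2)[OF sgn_in[OF False]], of "norm u"]
        mult_left_mono[OF b(2)[OF sgn_in[OF False]], of "norm u"]
      by (simp add: F_eq[of u] mult.commute)
  qed (simp add: zero)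
  then have "F a * norm u \<le> F u" "F u \<le> F b * norm u" for u
    by blast+
  moreover have "F a > 0" "F b > 0"
    using a(1) b(1) by (auto intro!: pos)
  ultimately show ?thesis
    by (intro that[of "F a" "F b"])
qed

text \<open>Smoothness covers all points but the origin, where the upper bound
  \<open>M * norm u\<close> squeezes \<open>F\<close> to 0.\<close>

lemma continuous_on_F: "continuous_on S F"
proof -
  have "isCont F u" for u
  proof (cases "u = 0")
    case True
    obtain M where M: "M > 0" "\<And>u. F u \<le> M * norm u"
      by (rule norm_bounds) (rule that)
    have "(F \<longlongrightarrow> 0) (at 0)"
    proof (rule Lim_null_comparison)
      show "\<forall>\<^sub>F u in at 0. norm (F u) \<le> M * norm u"
        using M(2) nonneg by (intro always_eventually) (simp add: abs_of_nonneg)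
      show "((\<lambda>u. M * norm u) \<longlongrightarrow> 0) (at 0)"
        by (auto intro!: tendsto_eq_intros)
    qed
    then show ?thesis
      using True zero by (simp add: isCont_def)
  next
    case False
    have "\<forall>u\<in>- {0}. isCont F u"
      using Ck_on_imp_continuous_on[OF Ck_F] by (simp add: continuous_on_eq_continuous_at open_Compl_zero)
    with False show ?thesis by simp
  qed
  then show ?thesis
    by (simp add: continuous_at_imp_continuous_on)
qed

end

text \<open>The inverse function argument, for a one-sided inverse: \<open>h\<close> is only assumed continuous,
  and \<open>Q\<close> straightens it.\<close>

lemma has_derivative_straightened:
  fixes h :: "'b::real_normed_vector \<Rightarrow> 'a::real_normed_vector"
  assumes Q: "(Q has_derivative (\<lambda>x. x)) (at (h v))"
    and cont: "continuous (at v) h"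
    and L: "bounded_linear L"
    and V: "open V" "v \<in> V" "\<And>w. w \<in> V \<Longrightarrow> Q (h w) = L w"
  shows "(h has_derivative L) (at v)"
proof -
  \<comment> \<open>Since \<open>Q (h w) = L w\<close> near \<open>v\<close>, the derivative of
    \<open>Q\<close> yields the wanted estimate, but with an error relative to the increment of
    \<open>h\<close> instead of \<open>w - v\<close>.\<close>
  have near: "\<exists>d>0. \<forall>w. norm (w - v) < d \<longrightarrow> norm (h w - h v - L (w - v)) \<le> e * norm (h w - h v)"
    if e: "e > 0" for e
  proof -
    obtain d0 where d0: "d0 > 0"
      "\<And>y. norm (y - h v) < d0 \<Longrightarrow> norm (Q y - Q (h v) - (y - h v)) \<le> e * norm (y - h v)"
      using Q[unfolded has_derivative_at_alt, THEN conjunct2, THEN spec, THEN mp, OF e] by blast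
    obtain d1 where d1: "d1 > 0" "\<And>w. dist w v < d1 \<Longrightarrow> dist (h w) (h v) < d0"
      using cont[unfolded continuous_at_eps_delta, THEN spec, THEN mp, OF d0(1)] by blast
    obtain d2 where d2: "d2 > 0" "\<And>w. dist w v < d2 \<Longrightarrow> w \<in> V"
      using V(1)[unfolded open_dist, THEN bspec, OF V(2)] by blast
    have "norm (h w - h v - L (w - v)) \<le> e * norm (h w - h v)" if "norm (w - v) < min d1 d2" for w
    proof -
      have "w \<in> V" "norm (h w - h v) < d0"
        using that d1(2)[of w] d2(2)[of w] by (simp_all add: dist_norm)
      then have "norm (L w - L v - (h w - h v)) \<le> e * norm (h w - h v)"
        using d0(2)[of "h w"] unfolding V(3)[OF \<open>w \<in> V\<close>] V(3)[OF V(2)] by blast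
      then show ?thesis
        by (simp add: linear_diff[OF bounded_linear.linear[OF L]] norm_minus_commute)
    qed
    moreover have "min d1 d2 > 0"
      using d1(1) d2(1) by simp
    ultimately show ?thesis by (intro exI[of _ "min d1 d2"] conjI allI impI)
  qed
  obtain K where K: "K > 0" "\<And>x. norm (L x) \<le> norm x * K"
    using bounded_linear.pos_bounded[OF L] by blast
  obtain d1 where d1: "d1 > 0"
    "\<And>w. norm (w - v) < d1 \<Longrightarrow> norm (h w - h v - L (w - v)) \<le> 1/2 * norm (h w - h v)"
    using near[OF half_gt_zero[OF zero_less_one]] by blast
  \<comment> \<open>With error factor 1/2 the increment of \<open>h\<close> can be absorbed on the
    left, which leaves a Lipschitz bound at \<open>v\<close>.\<close>
  have lip: "norm (h w - h v) \<le> 2 * K * norm (w - v)" if "norm (w - v) < d1" for w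
  proof -
    have "norm (h w - h v) \<le> 2 * (norm (w - v) * K)"
      using d1(2)[OF that] K(2)[of "w - v"] norm_triangle_ineq2[of "h w - h v" "L (w - v)"] by linarith
    then show ?thesis by (simp only: mult_ac)
  qed
  show ?thesis
    unfolding has_derivative_at_alt
  proof (intro conjI L allI impI)
    fix e :: real assume "e > 0"
    \<comment> \<open>Chosen to cancel the Lipschitz constant \<open>2 * K\<close>.\<close>
    then have "e / (2 * K) > 0" using K(1) by simp
    from near[OF this] obtain d2 where d2: "d2 > 0"
      "\<And>w. norm (w - v) < d2 \<Longrightarrow> norm (h w - h v - L (w - v)) \<le> e / (2 * K) * norm (h w - h v)"
      by blast
    have "norm (h w - h v - L (w - v)) \<le> e * norm (w - v)" if "norm (w - v) < min d1 d2" for w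
    proof -
      have "norm (h w - h v - L (w - v)) \<le> e / (2 * K) * norm (h w - h v)"
        using d2(2) that by simp
      also have "\<dots> \<le> e / (2 * K) * (2 * K * norm (w - v))"
        by (rule mult_left_mono[OF lip]) (use that \<open>e / (2 * K) > 0\<close> in simp_all)
      also have "\<dots> = e * norm (w - v)"
        using K(1) by simp
      finally show ?thesis .
    qed
    moreover have "min d1 d2 > 0"
      using d1(1) d2(1) by simp
    ultimately show "\<exists>d>0. \<forall>w. norm (w - v) < d \<longrightarrow>
        norm (h w - h v - L (w - v)) \<le> e * norm (w - v)"
      by blast
  qed
qed

subsection \<open>The lift of a linear surjection\<close>

locale minkowski_surjection = minkowski_space F
  for F :: "'a::real_normed_vector \<Rightarrow> real" +
  fixes \<mu> :: "'a \<Rightarrow> 'b::real_normed_vector"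
  assumes finite_dimensional_target: "finite_dimensional TYPE('b)"
    and linear: "linear \<mu>" and surj: "surj \<mu>"
begin

section \<open>Minimisers on fibres: first-order condition and uniqueness\<close>

definition minimal :: "'a \<Rightarrow> bool" where
  "minimal u \<longleftrightarrow> (\<forall>x. \<mu> x = \<mu> u \<longrightarrow> F u \<le> F x)"

lemma minimal_line:
  assumes "minimal u" "\<mu> k = 0"
  shows "F u \<le> F (u + t *\<^sub>R k)"
  using assms unfolding minimal_def by (simp add: linear_add[OF linear] linear_cmul[OF linear])

lemma energy_mono: "F a \<le> F b \<Longrightarrow> energy a \<le> energy b"
  using nonneg[of a] by (simp add: energy_def power_mono)

text \<open>Fermat's condition: the line in direction \<open>k\<close> stays in the fibre, so the
  energy along it is minimal at parameter 0.\<close>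

lemma minimal_critical:
  assumes "minimal u" "u \<noteq> 0" "\<mu> k = 0"
  shows "frechet_derivative energy (at u) k = 0"
proof -
  have "((\<lambda>t. energy (u + t *\<^sub>R k)) has_real_derivative
      frechet_derivative energy (at (u + 0 *\<^sub>R k)) k) (at 0)"
    by (rule energy_derivative_along_line(1)) (use assms(2) in simp)
  then show ?thesis
    using DERIV_local_min[of "\<lambda>t. energy (u + t *\<^sub>R k)" _ 0 1] energy_mono[OF minimal_line[OF assms(1,3)]]
    by simp
qed

text \<open>Along the segment from \<open>u\<close> to \<open>u'\<close> the energy is strictly
  convex and critical at \<open>u\<close>, so it would be strictly larger at \<open>u'\<close>; yet
  both are minimal in the same fibre.\<close>

lemma minimal_unique:
  assumes "minimal u" "minimal u'" "\<mu> u = \<mu> u'"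
  shows "u = u'"
proof (rule ccontr)
  assume "u \<noteq> u'"
  define k where "k = u' - u"
  have k: "k \<noteq> 0" "\<mu> k = 0"
    using \<open>u \<noteq> u'\<close> assms(3) by (simp_all add: k_def linear_diff[OF linear])
  have F_eq: "F u = F u'"
    using assms unfolding minimal_def by (intro antisym) simp_all
  have "u \<noteq> 0"
  proof
    assume "u = 0"
    with F_eq zero have "F u' = 0" by simp
    with pos[of u'] have "u' = 0" by force
    with \<open>u = 0\<close> \<open>u \<noteq> u'\<close> show False by simp
  qed
  \<comment> \<open>The whole line lies in the fibre, where \<open>F\<close> is at least
    \<open>F u > 0\<close>; it thus avoids the origin, and the energy is smooth along it.\<close>
  have nz: "u + t *\<^sub>R k \<noteq> 0" for t
  proof
    assume "u + t *\<^sub>R k = 0"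
    with minimal_line[OF assms(1) k(2), of t] pos[OF \<open>u \<noteq> 0\<close>] zero show False by simp
  qed
  let ?g = "\<lambda>t. frechet_derivative energy (at (u + t *\<^sub>R k)) k"
  have "?g 0 = 0"
    using minimal_critical[OF assms(1) \<open>u \<noteq> 0\<close> k(2)] by simp
  obtain \<xi> :: real where \<xi>: "0 < \<xi>" "\<xi> < 1"
    "energy (u + 1 *\<^sub>R k) - energy (u + 0 *\<^sub>R k) = (1 - 0) * ?g \<xi>"
    using MVT2[of 0 1 "\<lambda>t. energy (u + t *\<^sub>R k)" ?g, OF zero_less_one energy_derivative_along_line(1)[OF nz]]
    by blast
  \<comment> \<open>The derivative of \<open>?g\<close> is the Hessian evaluated on
    \<open>k\<close>, which is positive.\<close>
  have "?g 0 < ?g \<xi>"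
    by (rule DERIV_pos_imp_increasing[OF \<xi>(1)])
      (blast intro: energy_derivative_along_line(2)[OF nz] hessian_sym_pos(2)[OF nz k(1)])
  with \<xi>(3) \<open>?g 0 = 0\<close> have "energy u < energy u'"
    by (simp add: k_def)
  with F_eq show False
    by (simp add: energy_def)
qed

section \<open>Existence of minimisers on fibres\<close>

lemma bounded_linear: "bounded_linear \<mu>"
  by (rule finite_dimensional_bounded_linear[OF finite_dimensional linear])

text \<open>An auxiliary linear right inverse, independent of \<open>F\<close>; it supplies
  comparison points that vary continuously with the fibre.\<close>

definition section_map :: "'b \<Rightarrow> 'a" where
  "section_map = (SOME s. linear s \<and> \<mu> \<circ> s = id)"

lemma linear_section_map: "linear section_map"
  and section_map: "\<mu> (section_map v) = v"
proof -
  have "linear section_map \<and> \<mu> \<circ> section_map = id"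
    unfolding section_map_def using linear_surjective_right_inverse[OF linear surj] by (rule someI_ex)
  then show "linear section_map" "\<mu> (section_map v) = v"
    by (simp_all add: fun_eq_iff)
qed

lemma bounded_linear_section_map: "bounded_linear section_map"
  by (rule finite_dimensional_bounded_linear[OF finite_dimensional_target linear_section_map])

text \<open>The part of the fibre on which \<open>F\<close> does not exceed its value at
  \<open>section_map v\<close> is compact, and points outside it cannot compete.\<close>

lemma minimal_exists: "\<exists>u. \<mu> u = v \<and> minimal u"
proof -
  obtain m M where m: "m > 0" "M > 0" "\<And>u. m * norm u \<le> F u" "\<And>u. F u \<le> M * norm u"
    by (rule norm_bounds) (rule that)
  let ?s = "section_map v"
  define K where "K = {u. \<mu> u = v} \<inter> {u. F u \<le> F ?s}"
  have "closed K"
    unfolding K_def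
    by (intro closed_Int closed_Collect_eq closed_Collect_le continuous_on_const continuous_on_F
        linear_continuous_on bounded_linear)
  moreover have "bounded K"
    unfolding bounded_iff
  proof (intro exI ballI)
    fix u assume "u \<in> K"
    then have "m * norm u \<le> F ?s"
      using m(3)[of u] by (simp add: K_def)
    then show "norm u \<le> F ?s / m"
      using m(1) by (simp add: field_simps)
  qed
  ultimately have "compact K"
    by (rule finite_dimensional_compact[OF finite_dimensional])
  moreover have "K \<noteq> {}"
    using section_map by (auto simp: K_def)
  ultimately obtain u where u: "u \<in> K" "\<And>x. x \<in> K \<Longrightarrow> F u \<le> F x"
    using continuous_attains_inf[OF _ _ continuous_on_F, of K] by blast
  have "F u \<le> F x" if "\<mu> x = v" for x
  proof (cases "x \<in> K")
    case False
    then show ?thesis using that u(1) by (simp add: K_def)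
  qed (rule u(2))
  then show ?thesis
    using u(1) by (intro exI[of _ u]) (simp add: K_def minimal_def)
qed

section \<open>The lift: homogeneity and continuity\<close>

definition lift :: "'b \<Rightarrow> 'a" where
  "lift v = (SOME u. \<mu> u = v \<and> minimal u)"

lemma lift: "\<mu> (lift v) = v"
  and minimal_lift: "minimal (lift v)"
  using someI_ex[OF minimal_exists[of v]] by (simp_all add: lift_def)

lemma lift_eqI: "\<mu> u = v \<Longrightarrow> minimal u \<Longrightarrow> lift v = u"
  by (rule minimal_unique[OF minimal_lift]) (simp_all add: lift)

lemma F_lift_le: "F (lift (\<mu> u)) \<le> F u"
  using minimal_lift[of "\<mu> u"] by (simp add: minimal_def lift)

lemma lift_nonzero: "v \<noteq> 0 \<Longrightarrow> lift v \<noteq> 0"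
  using lift[of v] linear_0[OF linear] by force

lemma lift_image_nonzero: "lift ` (- {0}) \<subseteq> - {0}"
  using lift_nonzero by (intro image_subsetI) simp

lemma lift_zero: "lift 0 = 0"
  by (rule lift_eqI) (simp_all add: minimal_def linear_0[OF linear] zero nonneg)

text \<open>Positive scaling carries fibres to fibres and multiplies \<open>F\<close> by a constant,
  so it preserves minimality; uniqueness concludes.\<close>

lemma lift_scaleR:
  assumes "c > 0"
  shows "lift (c *\<^sub>R v) = c *\<^sub>R lift v"
proof (rule lift_eqI)
  show "\<mu> (c *\<^sub>R lift v) = c *\<^sub>R v"
    by (simp add: linear_cmul[OF linear] lift)
  show "minimal (c *\<^sub>R lift v)"
    unfolding minimal_def
  proof (intro allI impI)
    fix x assume "\<mu> x = \<mu> (c *\<^sub>R lift v)"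
    then have "\<mu> (inverse c *\<^sub>R x) = v"
      using assms by (simp add: linear_cmul[OF linear] lift)
    then have "F (lift v) \<le> F (inverse c *\<^sub>R x)"
      using F_lift_le[of "inverse c *\<^sub>R x"] by simp
    then show "F (c *\<^sub>R lift v) \<le> F x"
      using assms by (simp add: homogeneous field_simps)
  qed
qed

text \<open>Lifts of a convergent sequence stay bounded by comparison with
  \<open>section_map\<close>. If some subsequence stayed away from \<open>lift v\<close>, a further
  one would converge; its limit is minimal over \<open>v\<close>, hence equal to
  \<open>lift v\<close>, a contradiction.\<close>

lemma continuous_lift: "isCont lift v"
  unfolding continuous_at_sequentially
proof (intro allI impI)
  fix x assume x: "x \<longlonglongrightarrow> v"
  obtain m M where m: "m > 0" "M > 0" "\<And>u. m * norm u \<le> F u" "\<And>u. F u \<le> M * norm u"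
    by (rule norm_bounds) (rule that)
  have "(\<lambda>n. section_map (x n)) \<longlonglongrightarrow> section_map v"
    by (rule bounded_linear.tendsto[OF bounded_linear_section_map x])
  then have "Bseq (\<lambda>n. section_map (x n))"
    by (intro convergent_imp_Bseq convergentI)
  then obtain R where R: "R > 0" "\<forall>n. norm (section_map (x n)) \<le> R"
    by (rule BseqE) (rule that)
  \<comment> \<open>The radius comes from \<open>m * norm (lift (x n)) \<le> F (lift (x n)) \<le> F
    (section_map (x n)) \<le> M * R\<close>.\<close>
  define T where "T = cball (0::'a) (M * R / m)"
  have "compact T"
    unfolding T_def by (rule finite_dimensional_compact[OF finite_dimensional]) (simp_all add: closed_cball bounded_cball)
  have in_T: "lift (x n) \<in> T" for n
  proof -
    have "m * norm (lift (x n)) \<le> F (section_map (x n))"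
      using m(3)[of "lift (x n)"] F_lift_le[of "section_map (x n)"] by (simp add: section_map)
    also have "\<dots> \<le> M * R"
      using m(4)[of "section_map (x n)"] mult_left_mono[OF R(2)[THEN spec, of n], of M] m(2) by linarith
    finally show ?thesis
      using m(1) by (simp add: T_def field_simps)
  qed
  show "(lift \<circ> x) \<longlonglongrightarrow> lift v"
  proof (rule tendstoI, rule ccontr)
    fix e :: real
    assume e: "e > 0" and "\<not> (\<forall>\<^sub>F n in sequentially. dist ((lift \<circ> x) n) (lift v) < e)"
    then obtain r :: "nat \<Rightarrow> nat" where r: "strict_mono r" "\<And>n. \<not> dist (lift (x (r n))) (lift v) < e"
      using not_eventually_sequentiallyD[of "\<lambda>n. dist ((lift \<circ> x) n) (lift v) < e"] by (auto simp: comp_def)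
    obtain l q where q: "strict_mono (q :: nat \<Rightarrow> nat)" and l: "((\<lambda>n. lift (x (r n))) \<circ> q) \<longlonglongrightarrow> l"
      using \<open>compact T\<close>[unfolded compact_def, THEN spec[of _ "\<lambda>n. lift (x (r n))"]] in_T by blast
    define y where "y = (\<lambda>n. x (r (q n)))"
    have y: "y \<longlonglongrightarrow> v"
      using LIMSEQ_subseq_LIMSEQ[OF x strict_mono_o[OF r(1) q]] by (simp add: y_def comp_def)
    have l: "(\<lambda>n. lift (y n)) \<longlonglongrightarrow> l"
      using l by (simp add: y_def comp_def)
    have "(\<lambda>n. \<mu> (lift (y n))) \<longlonglongrightarrow> \<mu> l"
      by (rule bounded_linear.tendsto[OF bounded_linear l])
    then have "\<mu> l = v"
      using LIMSEQ_unique[OF _ y] by (simp add: lift)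
    moreover have "minimal l"
      unfolding minimal_def
    proof (intro allI impI)
      fix z assume z: "\<mu> z = \<mu> l"
      have isCont_F: "isCont F u" for u
        using continuous_on_F[of UNIV] by (simp add: continuous_on_eq_continuous_at)
      \<comment> \<open>The competitor \<open>z\<close> over \<open>v\<close> is shifted into the
        fibre over \<open>y n\<close>, where it can be compared with \<open>lift (y n)\<close>; the
        shift tends to 0.\<close>
      have "(\<lambda>n. z + section_map (y n - v)) \<longlonglongrightarrow> z + section_map (v - v)"
        by (intro tendsto_intros bounded_linear.tendsto[OF bounded_linear_section_map] y)
      then have "(\<lambda>n. z + section_map (y n - v)) \<longlonglongrightarrow> z"
        by (simp add: linear_0[OF linear_section_map])
      then have "(\<lambda>n. F (z + section_map (y n - v))) \<longlonglongrightarrow> F z"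
        by (rule isCont_tendsto_compose[OF isCont_F])
      moreover have "(\<lambda>n. F (lift (y n))) \<longlonglongrightarrow> F l"
        by (rule isCont_tendsto_compose[OF isCont_F l])
      moreover have "F (lift (y n)) \<le> F (z + section_map (y n - v))" for n
        using F_lift_le[of "z + section_map (y n - v)"] z \<open>\<mu> l = v\<close>
        by (simp add: linear_add[OF linear] section_map)
      ultimately show "F l \<le> F z"
        by (intro LIMSEQ_le[of "\<lambda>n. F (lift (y n))" _ "\<lambda>n. F (z + section_map (y n - v))"]) auto
    qed
    ultimately have "lift v = l"
      by (rule lift_eqI)
    with l e have "\<forall>\<^sub>F n in sequentially. dist (lift (y n)) (lift v) < e"
      by (simp add: tendstoD)
    then obtain n where "dist (lift (y n)) (lift v) < e"
      unfolding eventually_sequentially by blast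
    with r(2)[of "q n"] show False by (simp add: y_def)
  qed
qed

text \<open>\<open>A u\<close> is to be the right inverse of \<open>\<mu>\<close> onto the orthogonal complement of its kernel
  with respect to the Hessian at \<open>u\<close>.\<close>

definition horizontal_lift :: "('a \<Rightarrow> 'b \<Rightarrow> 'a) \<Rightarrow> bool" where
  "horizontal_lift A \<longleftrightarrow>
     (\<forall>k w. Ck_on k (\<lambda>u. A u w) (- {0})) \<and>
     (\<forall>u w. u \<noteq> 0 \<longrightarrow> \<mu> (A u w) = w) \<and>
     (\<forall>u w k. u \<noteq> 0 \<longrightarrow> \<mu> k = 0 \<longrightarrow> hessian energy u (A u w) k = 0) \<and>
     (\<forall>v. v \<noteq> 0 \<longrightarrow> (lift has_derivative A (lift v)) (at v))"

text \<open>\<open>S\<close> is a basis of the kernel and \<open>c u\<close> its dual basis for the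
  Hessian at \<open>u\<close>; together they express the orthogonal projection onto the kernel
  smoothly in \<open>u\<close>. The derivative of the lift then follows from
  \<open>has_derivative_straightened\<close>.\<close>

lemma horizontal_lift_exists: "\<exists>A. horizontal_lift A"
proof -
  obtain S where S: "S \<subseteq> {x. \<mu> x = 0}" "independent S" "{x. \<mu> x = 0} \<subseteq> span S"
    by (rule real_vector.maximal_independent_subset)
  obtain B :: "'a set" where B: "finite B" "span B = UNIV"
    using finite_dimensional unfolding finite_dimensional_def by blast
  have finS: "finite S"
    using real_vector.independent_span_bound[OF B(1) S(2)] B(2) by simp
  have subspace_ker: "subspace {x. \<mu> x = 0}"
    by (rule linear_subspace_kernel[OF linear])
  let ?H = "hessian energy"
  obtain c where c: "\<And>k i. i \<in> S \<Longrightarrow> Ck_on k (\<lambda>u. c u i) (- {0})"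
    "\<And>u i. i \<in> S \<Longrightarrow> u \<in> - {0} \<Longrightarrow> c u i \<in> span S"
    "\<And>u i j. i \<in> S \<Longrightarrow> j \<in> S \<Longrightarrow> u \<in> - {0} \<Longrightarrow> ?H u (c u i) j = (if i = j then 1 else 0)"
  proof (rule smooth_dual_basis[OF finite_dimensional open_Compl_zero _ _ _ _ finS S(2), of ?H])
    show "linear (\<lambda>x. ?H u x y)" "linear (\<lambda>y. ?H u x y)" if "u \<in> - {0}" for u x y
      using that by (simp_all add: linear_hessian)
    show "?H u x x > 0" if "u \<in> - {0}" "x \<noteq> 0" for u x
      using that by (simp add: hessian_sym_pos(2))
    show "Ck_on k (\<lambda>u. ?H u x y) (- {0})" for k x y
      by (rule Ck_on_hessian[OF open_Compl_zero Ck_energy])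
  qed (rule that)
  have c_ker: "\<mu> (c u i) = 0" if "i \<in> S" "u \<noteq> 0" for u i
    using c(2)[OF that(1)] real_vector.span_minimal[OF S(1) subspace_ker] that(2) by auto
  have orth_ker: "?H u x k = 0" if "u \<noteq> 0" "\<And>j. j \<in> S \<Longrightarrow> ?H u x j = 0" "\<mu> k = 0" for u x k
  proof -
    have "k \<in> span S" using S(3) that(3) by blast
    then show ?thesis
      by (induction rule: real_vector.span_induct_alt)
        (simp_all add: linear_0[OF linear_hessian(2)[OF that(1)]] linear_add[OF linear_hessian(2)[OF that(1)]]
          linear_cmul[OF linear_hessian(2)[OF that(1)]] that(2))
  qed
  \<comment> \<open>The sum is the orthogonal projection of \<open>section_map w\<close> to the
    kernel: removing it keeps the image under \<open>\<mu>\<close> and leaves a horizontal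
    vector.\<close>
  define A where "A u w = section_map w - (\<Sum>i\<in>S. ?H u (section_map w) i *\<^sub>R c u i)" for u w
  have Ck_A: "Ck_on k (\<lambda>u. A u w) (- {0})" for k w
    unfolding A_def
    by (intro Ck_on_diff Ck_on_sum Ck_on_scaleR Ck_on_const open_Compl_zero c(1)
        Ck_on_hessian[OF open_Compl_zero Ck_energy])
  have A_section: "\<mu> (A u w) = w" if "u \<noteq> 0" for u w
    unfolding A_def using c_ker[OF _ that]
    by (simp add: linear_diff[OF linear] linear_sum[OF linear] linear_cmul[OF linear] section_map)
  have sum_dual: "?H u (\<Sum>i\<in>S. x i *\<^sub>R c u i) j = x j" if "u \<noteq> 0" "j \<in> S" for u x j
  proof -
    have "?H u (\<Sum>i\<in>S. x i *\<^sub>R c u i) j = (\<Sum>i\<in>S. x i * (if i = j then 1 else 0))"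
      using that c(3) by (simp add: linear_sum[OF linear_hessian(1)] linear_cmul[OF linear_hessian(1)] cong: sum.cong)
    then show ?thesis
      using that(2) finS by (simp add: if_distrib cong: if_cong)
  qed
  have A_orth: "?H u (A u w) k = 0" if "u \<noteq> 0" "\<mu> k = 0" for u w k
  proof (rule orth_ker[OF that(1) _ that(2)])
    show "?H u (A u w) j = 0" if "j \<in> S" for j
      unfolding A_def using sum_dual[OF \<open>u \<noteq> 0\<close> that]
      by (simp add: linear_diff[OF linear_hessian(1)[OF \<open>u \<noteq> 0\<close>]])
  qed
  have lin_A: "linear (A u)" if "u \<noteq> 0" for u
    unfolding A_def
    by (rule linearI)
      (simp_all add: linear_add[OF linear_section_map] linear_cmul[OF linear_section_map]
        linear_add[OF linear_hessian(1)[OF that]] linear_cmul[OF linear_hessian(1)[OF that]]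
        scaleR_add_left sum.distrib scaleR_diff_right scaleR_sum_right)
  have A_derivative: "(lift has_derivative A (lift v)) (at v)" if "v \<noteq> 0" for v
  proof -
    define u where "u = lift v"
    have u: "u \<noteq> 0"
      using lift_nonzero[OF that] by (simp add: u_def)
    \<comment> \<open>\<open>A\<close> and \<open>c\<close> are frozen at \<open>u\<close>, so only
      the gradient varies. The first term records the fibre, the second the derivatives of the
      energy along the kernel, which vanish at nonzero lifts; hence
      \<open>Q (lift w) = A u w\<close> for \<open>w \<noteq> 0\<close>.\<close>
    define Q where "Q x = A u (\<mu> x) + (\<Sum>i\<in>S. frechet_derivative energy (at x) i *\<^sub>R c u i)" for x
    have bA: "bounded_linear (A u)"
      by (rule finite_dimensional_bounded_linear[OF finite_dimensional_target lin_A[OF u]])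
    have D: "(Q has_derivative (\<lambda>x. A u (\<mu> x) + (\<Sum>i\<in>S. ?H u x i *\<^sub>R c u i))) (at u)"
      unfolding Q_def
      by (intro has_derivative_add has_derivative_sum has_derivative_scaleR_left gradient_has_derivative u
          bounded_linear.has_derivative[OF bA] bounded_linear_imp_has_derivative[OF bounded_linear])
    have "A u (\<mu> x) + (\<Sum>i\<in>S. ?H u x i *\<^sub>R c u i) = x" for x
    proof -
      \<comment> \<open>The defect of the splitting into horizontal and kernel parts lies in the
        kernel and is orthogonal to it, so positive definiteness forces it to be 0.\<close>
      define d where "d = A u (\<mu> x) + (\<Sum>i\<in>S. ?H u x i *\<^sub>R c u i) - x"
      have ker: "\<mu> d = 0"
        unfolding d_def using c_ker[OF _ u]
        by (simp add: linear_diff[OF linear] linear_add[OF linear] linear_sum[OF linear]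
            linear_cmul[OF linear] A_section[OF u])
      have "?H u d j = 0" if "j \<in> S" for j
        unfolding d_def using sum_dual[OF u that] A_orth[OF u, of j] S(1) that
        by (auto simp: linear_diff[OF linear_hessian(1)[OF u]] linear_add[OF linear_hessian(1)[OF u]])
      from orth_ker[OF u this ker] have "?H u d d = 0" .
      then have "d = 0"
        using hessian_sym_pos(2)[OF u, of d] by force
      then show ?thesis by (simp add: d_def)
    qed
    with D have "(Q has_derivative (\<lambda>x. x)) (at (lift v))"
      by (simp add: u_def)
    moreover have "Q (lift w) = A u w" if "w \<in> - {0}" for w
    proof -
      have "frechet_derivative energy (at (lift w)) i = 0" if "i \<in> S" for i
        using minimal_critical[OF minimal_lift lift_nonzero] \<open>w \<in> - {0}\<close> S(1) that by auto
      then show ?thesis by (simp add: Q_def lift)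
    qed
    ultimately show ?thesis
      using has_derivative_straightened[OF _ continuous_lift bA open_Compl_zero] that by (simp add: u_def)
  qed
  have "horizontal_lift A"
    unfolding horizontal_lift_def using Ck_A A_section A_orth A_derivative by blast
  then show ?thesis by (rule exI[of horizontal_lift])
qed

section \<open>Smoothness of the lift\<close>

definition hlift :: "'a \<Rightarrow> 'b \<Rightarrow> 'a" where
  "hlift = (SOME A. horizontal_lift A)"

lemma horizontal_lift_hlift: "horizontal_lift hlift"
  unfolding hlift_def by (rule someI_ex[OF horizontal_lift_exists])

lemmas hlift_conjs = horizontal_lift_hlift[unfolded horizontal_lift_def]

lemma Ck_hlift: "Ck_on k (\<lambda>u. hlift u w) (- {0})"
  by (rule hlift_conjs[THEN conjunct1, rule_format])

lemma hlift_section: "u \<noteq> 0 \<Longrightarrow> \<mu> (hlift u w) = w"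
  by (rule hlift_conjs[THEN conjunct2, THEN conjunct1, rule_format])

lemma hessian_hlift: "u \<noteq> 0 \<Longrightarrow> \<mu> x = 0 \<Longrightarrow> hessian energy u (hlift u w) x = 0"
  by (rule hlift_conjs[THEN conjunct2, THEN conjunct2, THEN conjunct1, rule_format])

lemma lift_has_derivative: "v \<noteq> 0 \<Longrightarrow> (lift has_derivative hlift (lift v)) (at v)"
  by (rule hlift_conjs[THEN conjunct2, THEN conjunct2, THEN conjunct2, rule_format])

text \<open>Bootstrapping: the derivative of \<open>lift\<close> at \<open>v\<close> is
  \<open>hlift (lift v)\<close>, a smooth map composed with \<open>lift\<close>, so each order of
  differentiability yields the next.\<close>

lemma Ck_lift: "Ck_on k lift (- {0})"
proof (induction k)
  case 0
  show ?case
    using continuous_lift by (simp add: continuous_at_imp_continuous_on)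
next
  case (Suc k)
  show ?case
  proof (rule Ck_on_SucI[OF open_Compl_zero])
    show "(lift has_derivative hlift (lift v)) (at v)" if "v \<in> - {0}" for v
      using that by (intro lift_has_derivative) simp
    show "Ck_on k (\<lambda>v. hlift (lift v) w) (- {0})" for w
      by (rule Ck_on_compose[OF finite_dimensional open_Compl_zero open_Compl_zero lift_image_nonzero
            Suc.IH Ck_hlift])
  qed
qed

lemma induced_homogeneous_nonlinear_lift: "induced_homogeneous_nonlinear_lift F \<mu> lift"
proof -
  have "is_arg_min F (\<lambda>x. x \<in> \<mu> -` {v}) u \<longleftrightarrow> \<mu> u = v \<and> minimal u" for u v
    unfolding is_arg_min_def minimal_def by (auto simp: not_less)
  moreover have "\<mu> u = v \<and> minimal u \<longleftrightarrow> u = lift v" for u v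
    using lift_eqI[of u v] lift[of v] minimal_lift[of v] by auto
  ultimately have "induced_lift F \<mu> lift"
    by (simp add: induced_lift_def)
  moreover have "nonlinear_lift \<mu> lift"
    unfolding nonlinear_lift_def smooth_on_def
    using Ck_lift continuous_lift lift by (auto simp: continuous_at_imp_continuous_on fun_eq_iff)
  moreover have "homogeneous_map lift"
    unfolding homogeneous_map_def using lift_scaleR by blast
  ultimately show ?thesis
    unfolding induced_homogeneous_nonlinear_lift_def by blast
qed

section \<open>The norm on the target space and its uniqueness\<close>

lemma minkowski_norm_lift: "minkowski_norm (\<lambda>v. F (lift v))"
proof -
  let ?G = "\<lambda>v. energy (lift v)"
  have Ck_F_lift: "Ck_on k (\<lambda>v. F (lift v)) (- {0})" and Ck_G: "Ck_on k ?G (- {0})" for k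
    by (rule Ck_on_compose[OF finite_dimensional open_Compl_zero open_Compl_zero lift_image_nonzero Ck_lift]
        Ck_F Ck_energy)+
  let ?D = "\<lambda>x. frechet_derivative energy (at x)" and ?H = "hessian energy"
  have horizontal: "\<mu> (section_map w - hlift (lift v) w) = 0" if "v \<noteq> 0" for v w
    using hlift_section[OF lift_nonzero[OF that]] by (simp add: linear_diff[OF linear] section_map)
  \<comment> \<open>The differential of the energy at \<open>lift v\<close> kills the kernel, so
    \<open>hlift (lift v) w\<close> may be replaced by \<open>section_map w\<close>. As this vector
    does not depend on \<open>v\<close>, the next differentiation acts on the gradient
    alone.\<close>
  have dG: "frechet_derivative ?G (at v) w = ?D (lift v) (section_map w)" if "v \<in> - {0}" for v w
  proof -
    from that have v: "v \<noteq> 0" by simp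
    note D = energy_has_derivative[OF lift_nonzero[OF v]]
    have "(?G has_derivative (\<lambda>w. ?D (lift v) (hlift (lift v) w))) (at v)"
      by (rule has_derivative_compose[OF lift_has_derivative[OF v] D])
    from frechet_derivative_at[OF this, THEN fun_cong, of w]
    have "frechet_derivative ?G (at v) w = ?D (lift v) (hlift (lift v) w)" ..
    with minimal_critical[OF minimal_lift lift_nonzero[OF v] horizontal[OF v]] show ?thesis
      by (simp add: linear_diff[OF has_derivative_linear[OF D]])
  qed
  have HG: "hessian ?G v a b = ?H (lift v) (hlift (lift v) a) (hlift (lift v) b)" if "v \<noteq> 0" for v a b
  proof -
    let ?A = "hlift (lift v)"
    note nz = lift_nonzero[OF that]
    \<comment> \<open>The vector \<open>section_map b\<close> in the second slot differs from
      \<open>?A b\<close> by an element of the kernel, which is orthogonal to the horizontal vector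
      \<open>?A a\<close>.\<close>
    have "hessian ?G v a b = ?H (lift v) (?A a) (section_map b)"
      by (rule hessian_eqI[OF open_Compl_zero _ Ck_G dG
            has_derivative_compose[OF lift_has_derivative[OF that] gradient_has_derivative[OF nz]]])
        (use that in simp)
    with hessian_hlift[OF nz horizontal[OF that], of a b] show ?thesis
      by (simp add: linear_diff[OF linear_hessian(2)[OF nz]])
  qed
  have "pos_def_matrix B (hessian ?G v)" if "is_basis B" "v \<noteq> 0" for B v
  proof -
    note nz = lift_nonzero[OF that(2)]
    have lin: "linear (\<lambda>a. hessian ?G v a b)" "linear (\<lambda>b. hessian ?G v a b)" for a b
      by (rule linear_hessian_left[OF open_Compl_zero _ Ck_G] linear_hessian_right[OF open_Compl_zero _ Ck_G],
          use that(2) in simp)+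
    have sym: "hessian ?G v a b = hessian ?G v b a" for a b
      unfolding HG[OF that(2)] by (rule hessian_sym_pos(1)[OF nz])
    have pos: "hessian ?G v a a > 0" if "a \<noteq> 0" for a
    proof -
      have "hlift (lift v) a \<noteq> 0"
        using hlift_section[OF nz, of a] that linear_0[OF linear] by force
      then show ?thesis
        unfolding HG[OF \<open>v \<noteq> 0\<close>] by (rule hessian_sym_pos(2)[OF nz])
    qed
    show ?thesis
      unfolding pos_def_matrix_iff[OF finite_basis[OF finite_dimensional_target that(1)] that(1) lin]
      by (intro conjI allI impI sym pos)
  qed
  then have "pos_def_matrix B (hessian (\<lambda>v. 1/2 * (F (lift v))\<^sup>2) v)" if "is_basis B" "v \<noteq> 0" for B v
    using that unfolding energy_def by blast
  moreover have "F (lift (c *\<^sub>R v)) = c * F (lift v)" if "c > 0" for c v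
    using that by (simp add: homogeneous lift_scaleR)
  moreover have "F (lift 0) = 0"
    by (simp add: lift_zero zero)
  ultimately show ?thesis
    unfolding minkowski_norm_def smooth_on_def
    by (intro conjI allI impI nonneg Ck_F_lift)
qed

text \<open>Passing from \<open>u\<close> to \<open>lift (\<mu> u)\<close> does not increase
  \<open>F\<close>, which gives one inclusion of balls; \<open>lift v\<close> is itself a preimage
  of \<open>v\<close>, which gives the other.\<close>

lemma minkowski_submersion_lift: "minkowski_submersion F (\<lambda>v. F (lift v)) \<mu>"
proof -
  have "\<mu> ` closed_unit_ball F = closed_unit_ball (\<lambda>v. F (lift v))"
  proof (intro equalityI subsetI)
    fix v assume "v \<in> \<mu> ` closed_unit_ball F"
    then obtain u where "v = \<mu> u" "F u \<le> 1"
      by (auto simp: closed_unit_ball_def)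
    with F_lift_le[of u] show "v \<in> closed_unit_ball (\<lambda>v. F (lift v))"
      by (simp add: closed_unit_ball_def)
  next
    fix v assume "v \<in> closed_unit_ball (\<lambda>v. F (lift v))"
    then show "v \<in> \<mu> ` closed_unit_ball F"
      by (intro image_eqI[of _ _ "lift v"]) (simp_all add: closed_unit_ball_def lift)
  qed
  then show ?thesis
    by (simp add: minkowski_submersion_def linear surj)
qed

text \<open>Both functions have the same unit ball, so by homogeneity the same sublevel sets at all
  positive levels.\<close>

lemma submersion_norm_eq:
  assumes "minkowski_norm G" "minkowski_submersion F G \<mu>"
  shows "G v = F (lift v)"
proof -
  interpret G: minkowski_space G
    by unfold_locales (fact finite_dimensional_target assms(1))+
  have G_le: "G v \<le> c \<longleftrightarrow> F (lift v) \<le> c" if "c > 0" for c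
  proof -
    have "w \<in> closed_unit_ball G \<longleftrightarrow> w \<in> closed_unit_ball (\<lambda>v. F (lift v))" for w
      using assms(2) minkowski_submersion_lift by (simp add: minkowski_submersion_def)
    then have "G (inverse c *\<^sub>R v) \<le> 1 \<longleftrightarrow> F (lift (inverse c *\<^sub>R v)) \<le> 1"
      by (simp add: closed_unit_ball_def)
    then show ?thesis
      using that by (simp add: G.homogeneous homogeneous lift_scaleR field_simps)
  qed
  show ?thesis
  proof (rule antisym)
    \<comment> \<open>Only positive levels can be compared, so a margin \<open>e > 0\<close> is
      added; this also covers the value 0.\<close>
    show "G v \<le> F (lift v)"
      by (rule field_le_epsilon) (use G_le nonneg[of "lift v"] in \<open>simp add: add_nonneg_pos\<close>)
    show "F (lift v) \<le> G v"
      by (rule field_le_epsilon) (use G_le[symmetric] G.nonneg[of v] in \<open>simp add: add_nonneg_pos\<close>)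
  qed
qed

text \<open>The infimum is attained at \<open>lift v\<close>.\<close>

lemma subduced_norm_eq: "subduced_norm F \<mu> v = F (lift v)"
  unfolding subduced_norm_def
proof (rule cInf_eq_minimum)
  show "F (lift v) \<in> {F u |u. \<mu> u = v}"
    using lift by blast
  show "F (lift v) \<le> x" if "x \<in> {F u |u. \<mu> u = v}" for x
    using that F_lift_le by blast
qed

text \<open>Carries statements about \<open>lift\<close> over to an arbitrary induced lift.\<close>

lemma induced_lift_unique:
  assumes "induced_lift F \<mu> h"
  shows "h v = lift v"
proof -
  have "induced_lift F \<mu> lift"
    using induced_homogeneous_nonlinear_lift by (simp add: induced_homogeneous_nonlinear_lift_def)
  then have "{h v} = {lift v}"
    using assms unfolding induced_lift_def by metis
  then show ?thesis by simp
qed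

end

theorem proposition4:
  fixes F1 :: "'a::real_normed_vector \<Rightarrow> real"
    and \<mu> :: "'a \<Rightarrow> 'b::real_normed_vector"
  assumes "finite_dimensional TYPE('a)"
    and "finite_dimensional TYPE('b)"
    and "minkowski_norm F1"
    and "linear \<mu>"
    and "surj \<mu>"
  shows "(\<exists>h. induced_homogeneous_nonlinear_lift F1 \<mu> h) \<and>
    ((\<exists>!F2. minkowski_norm F2 \<and> minkowski_submersion F1 F2 \<mu>) \<and>
     (\<forall>F2. minkowski_norm F2 \<and> minkowski_submersion F1 F2 \<mu> \<longrightarrow>
        (\<forall>v. F2 v = subduced_norm F1 \<mu> v))) \<and>
    (\<forall>h F2. induced_homogeneous_nonlinear_lift F1 \<mu> h \<and>
        minkowski_norm F2 \<and> minkowski_submersion F1 F2 \<mu> \<longrightarrow>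
        (\<forall>v. F1 (h v) = F2 v))"
proof -
  interpret minkowski_surjection F1 \<mu>
    by (intro minkowski_surjection.intro minkowski_space.intro minkowski_surjection_axioms.intro assms)
  \<comment> \<open>Every admissible \<open>F2\<close> is this one function, so uniqueness, the
    infimum formula and the relation to the lift all reduce to facts about
    \<open>F1 (lift v)\<close>.\<close>
  have unique: "F2 = (\<lambda>v. F1 (lift v))" if "minkowski_norm F2 \<and> minkowski_submersion F1 F2 \<mu>" for F2
    using submersion_norm_eq that by (intro ext) blast
  show ?thesis
  proof (intro conjI allI impI)
    show "\<exists>h. induced_homogeneous_nonlinear_lift F1 \<mu> h"
      by (rule exI, rule induced_homogeneous_nonlinear_lift)
    show "\<exists>!F2. minkowski_norm F2 \<and> minkowski_submersion F1 F2 \<mu>"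
      by (rule ex1I[where a = "\<lambda>v. F1 (lift v)"])
        (rule conjI minkowski_norm_lift minkowski_submersion_lift unique, assumption?)+
    show "F2 v = subduced_norm F1 \<mu> v" if "minkowski_norm F2 \<and> minkowski_submersion F1 F2 \<mu>" for F2 v
      by (simp only: unique[OF that] subduced_norm_eq)
    show "F1 (h v) = F2 v" if "induced_homogeneous_nonlinear_lift F1 \<mu> h \<and>
        minkowski_norm F2 \<and> minkowski_submersion F1 F2 \<mu>" for h F2 v
    proof -
      from that have "induced_lift F1 \<mu> h"
        unfolding induced_homogeneous_nonlinear_lift_def by blast
      then show ?thesis
        using unique[of F2] that by (simp only: induced_lift_unique)
    qed
  qed
qed

end
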